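(* Let $m, l_1,\ldots,l_m \in \mathbb{N}$ with $l_1\le \cdots \le l_m$, and $l_2\ge 2$ if $m \ge 2$. Let $G=\Theta(l_1,\ldots,l_m)$. Then the total graph $T(G)$ is equitably $k$-choosable for every $k \geq m+2$.
   Context: All graphs are finite and simple. $\Theta(l_1,\ldots,l_m)$ denotes the graph consisting of two vertices $u,w$ joined by $m$ internally disjoint paths of lengths $l_1,\ldots,l_m$. The total graph $T(G)$ of a graph $G$ has vertex set $V(G)\cup E(G)$, two elements being adjacent in $T(G)$ iff they are adjacent or incident in $G$. A $k$-assignment $L$ for a graph $G$ assigns to each vertex $v$ a set $L(v)$ of exactly $k$ colors. An equitable $L$-coloring of $G$ is a proper coloring $f$ of $G$ with $f(v)\in L(v)$ for all $v$, such that no color is used on more than $\lceil |V(G)|/k\rceil$ vertices. $G$ is equitably $k$-choosable if it has an equitable $L$-coloring for every $k$-assignment $L$. *)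

theory Defs
  imports Complex_Main
begin

text \<open>Vertices of the theta graph: the two branch vertices u, w and the internal
  vertex number j (0 < j < l_i) of path i (i < m).\<close>
datatype theta_vertex = TU | TW | TI nat nat

definition theta_pv :: "nat list \<Rightarrow> nat \<Rightarrow> nat \<Rightarrow> theta_vertex" where
  "theta_pv ls i j = (if j = 0 then TU else if j = ls ! i then TW else TI i j)"

definition theta_V :: "nat list \<Rightarrow> theta_vertex set" where
  "theta_V ls = {TU, TW} \<union> {TI i j | i j. i < length ls \<and> 0 < j \<and> j < ls ! i}"

definition theta_E :: "nat list \<Rightarrow> theta_vertex set set" where
  "theta_E ls = {{theta_pv ls i j, theta_pv ls i (Suc j)} | i j. i < length ls \<and> j < ls ! i}"

definition total_V :: "'a set \<Rightarrow> 'a set set \<Rightarrow> ('a + 'a set) set" where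
  "total_V V E = Inl ` V \<union> Inr ` E"

fun total_adj :: "'a set set \<Rightarrow> ('a + 'a set) \<Rightarrow> ('a + 'a set) \<Rightarrow> bool" where
  "total_adj E (Inl v) (Inl v') = ({v, v'} \<in> E \<and> v \<noteq> v')"
| "total_adj E (Inl v) (Inr e) = (v \<in> e)"
| "total_adj E (Inr e) (Inl v) = (v \<in> e)"
| "total_adj E (Inr e) (Inr e') = (e \<noteq> e' \<and> e \<inter> e' \<noteq> {})"

definition k_assignment :: "'v set \<Rightarrow> ('v \<Rightarrow> nat set) \<Rightarrow> nat \<Rightarrow> bool" where
  "k_assignment V L k \<longleftrightarrow> (\<forall>v\<in>V. finite (L v) \<and> card (L v) = k)"

definition equitable_L_coloring ::
  "'v set \<Rightarrow> ('v \<Rightarrow> 'v \<Rightarrow> bool) \<Rightarrow> ('v \<Rightarrow> nat set) \<Rightarrow> nat \<Rightarrow> ('v \<Rightarrow> nat) \<Rightarrow> bool" where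
  "equitable_L_coloring V adj L k f \<longleftrightarrow>
     (\<forall>v\<in>V. f v \<in> L v) \<and>
     (\<forall>v\<in>V. \<forall>v'\<in>V. adj v v' \<longrightarrow> f v \<noteq> f v') \<and>
     (\<forall>c. card {v\<in>V. f v = c} \<le> nat (ceiling (real (card V) / real k)))"

definition equitably_choosable :: "'v set \<Rightarrow> ('v \<Rightarrow> 'v \<Rightarrow> bool) \<Rightarrow> nat \<Rightarrow> bool" where
  "equitably_choosable V adj k \<longleftrightarrow>
     (\<forall>L. k_assignment V L k \<longrightarrow> (\<exists>f. equitable_L_coloring V adj L k f))"

end

theory Submission
  imports Defs
begin

text \<open>Position \<open>j\<close> on leg \<open>i\<close> is the \<open>j\<close>-th element (edge, vertex, edge, \<dots>) of path \<open>i\<close> after \<open>u\<close>. In these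
  coordinates the total graph consists of the two vertices \<open>TU\<close>, \<open>TW\<close> and \<open>m\<close> legs of odd length; positions
  on a leg are adjacent at distance at most two, and the first (last) positions of all legs together with \<open>TU\<close>
  (\<open>TW\<close>) form a clique.

  The vertices are coloured in blocks of at most \<open>k\<close> vertices, each block with distinct colours, so that every
  colour occurs at most as often as there are blocks. A block can be coloured greedily if its vertices can be
  listed such that the \<open>r\<close>-th last one has at most \<open>r - 1\<close> neighbours in blocks coloured before. Once \<open>TW\<close> and the end of
  all but one of the legs are removed, what is left is a ``spider'' around \<open>TU\<close>, and a block of vertices at the
  tips of a spider has this property as soon as it contains three vertices of one leg. For \<open>k \<ge> m + 3\<close> also
  the block around \<open>TW\<close> does. For \<open>k = m + 2\<close> the greedy colouring of that block may get stuck at its very last vertex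
  only, which is prevented by controlling one colour used on the spider. For \<open>m \<ge> 3\<close> this leaves the case that all paths have
  length at most two, where three blocks are written down explicitly, except for \<open>K\<^bsub>1,1,2\<^esub>\<close> and \<open>K\<^bsub>1,1,3\<^esub>\<close>.\<close>

section \<open>Colouring in blocks\<close>

definition bounded_colouring ::
  "('v \<Rightarrow> 'v \<Rightarrow> bool) \<Rightarrow> ('v \<Rightarrow> nat set) \<Rightarrow> nat \<Rightarrow> 'v set \<Rightarrow> ('v \<Rightarrow> nat) \<Rightarrow> bool" where
  "bounded_colouring adj L t V f \<longleftrightarrow>
     (\<forall>v\<in>V. f v \<in> L v) \<and> (\<forall>v\<in>V. \<forall>v'\<in>V. adj v v' \<longrightarrow> f v \<noteq> f v') \<and>
     (\<forall>c. card {v\<in>V. f v = c} \<le> t)"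

text \<open>Colours are chosen in the order of decreasing \<open>D\<close>: when \<open>x\<close> is
  reached, only vertices \<open>y\<close> with \<open>D x \<le> D y\<close> are coloured, fewer than
  the at least \<open>k - D x\<close> colours of \<open>A x\<close>. In the induction a vertex of
  smallest \<open>D\<close> is removed and coloured last.\<close>

lemma greedy_distinct:
  fixes A :: "'v \<Rightarrow> 'c set" and D :: "'v \<Rightarrow> nat"
  assumes "finite S" and "\<And>x. x \<in> S \<Longrightarrow> finite (A x)"
    and "\<And>x. x \<in> S \<Longrightarrow> card {y\<in>S. D x \<le> D y} + D x \<le> k"
    and "\<And>x. x \<in> S \<Longrightarrow> k \<le> card (A x) + D x"
  shows "\<exists>g. inj_on g S \<and> (\<forall>x\<in>S. g x \<in> A x)"
  using assms
proof (induction "card S" arbitrary: S)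
  case 0
  then show ?case by auto
next
  case (Suc s)
  then have "S \<noteq> {}" by auto
  then obtain x where x: "x \<in> S" "\<And>y. y \<in> S \<Longrightarrow> D x \<le> D y"
    using ex_min_if_finite[of "D ` S"] \<open>finite S\<close> by (auto simp: not_less)
  let ?S = "S - {x}"
  have "\<exists>g. inj_on g ?S \<and> (\<forall>x\<in>?S. g x \<in> A x)"
  proof (rule Suc.hyps)
    show "s = card ?S" using Suc.hyps(2) x(1) \<open>finite S\<close> by simp
    fix y assume y: "y \<in> ?S"
    have "card {z \<in> ?S. D y \<le> D z} \<le> card {z \<in> S. D y \<le> D z}"
      by (rule card_mono) (use \<open>finite S\<close> in auto)
    then show "card {z \<in> ?S. D y \<le> D z} + D y \<le> k" using Suc.prems(3)[of y] y by simp
  qed (use Suc.prems in auto)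
  then obtain g where g: "inj_on g ?S" "\<forall>x\<in>?S. g x \<in> A x" by blast
  have "{y \<in> S. D x \<le> D y} = S" using x by auto
  then have "card S \<le> card (A x)" using Suc.prems(3)[OF x(1)] Suc.prems(4)[OF x(1)] by simp
  moreover have "card (g ` ?S) < card S"
    using card_image_le[of ?S g] Suc.hyps(2) x(1) \<open>finite S\<close> by (simp add: card_gt_0_iff)
  ultimately have "\<not> A x \<subseteq> g ` ?S"
    using card_mono[of "g ` ?S" "A x"] \<open>finite S\<close> by auto
  then obtain c where c: "c \<in> A x" "c \<notin> g ` ?S" by blast
  have "inj_on (g(x := c)) S"
    using g(1) c(2) unfolding inj_on_def by (auto simp: image_iff) 
  moreover have "\<forall>y\<in>S. (g(x := c)) y \<in> A y" using g(2) c(1) by auto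
  ultimately show ?case by blast
qed

text \<open>Checks the premise of \<open>greedy_distinct\<close> for a block of at most
  \<open>k\<close> vertices. The vertex \<open>p\<close> is not counted when \<open>D x = 1\<close>,
  and neither \<open>p\<close> nor \<open>q\<close> when \<open>D x = 2\<close>. Only vertices with
  \<open>D x \<ge> 3\<close>, all of them in \<open>U\<close>, have to be counted
  separately.\<close>

lemma rank_condition:
  fixes D :: "'v \<Rightarrow> nat"
  assumes "finite S" "card S \<le> k" "p \<in> S" "q \<in> S" "p \<noteq> q" "D p = 0" "D q \<le> 1"
    and small: "\<And>x. x \<in> S \<Longrightarrow> x \<notin> U \<Longrightarrow> D x \<le> 2"
    and large: "\<And>x. x \<in> S \<Longrightarrow> 3 \<le> D x \<Longrightarrow> card {y\<in>S. D x \<le> D y \<and> y \<in> U} + D x \<le> k"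
    and x: "x \<in> S"
  shows "card {y\<in>S. D x \<le> D y} + D x \<le> k"
proof -
  consider "D x = 0" | "D x = 1" | "D x = 2" | "3 \<le> D x" by linarith
  then show ?thesis
  proof cases
    case 1
    then show ?thesis using assms(2) by simp
  next
    case 2
    have "card {y\<in>S. D x \<le> D y} \<le> card (S - {p})"
      by (rule card_mono) (use 2 assms in auto)
    moreover have "card S > 0" using assms(1,3) card_gt_0_iff by blast
    ultimately show ?thesis using 2 assms(1-3) by simp
  next
    case 3
    have "card {y\<in>S. D x \<le> D y} \<le> card (S - {p, q})"
      by (rule card_mono) (use 3 assms in auto)
    moreover have "card {p, q} = 2" using assms(5) by simp
    then have "card S \<ge> 2" "card (S - {p, q}) = card S - 2" 
      using assms(1,3,4) card_mono[of S "{p, q}"] card_Diff_subset[of "{p, q}" S] by auto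
    ultimately show ?thesis using 3 assms(2) by simp
  next
    case 4
    have "{y\<in>S. D x \<le> D y} = {y\<in>S. D x \<le> D y \<and> y \<in> U}" using 4 small by force
    then show ?thesis using large[OF x 4] by simp
  qed
qed

text \<open>Used for the last two vertices of a block: at most \<open>s\<close> colours \<open>Z\<close> are taken by the others.\<close>

lemma distinct_pair:
  assumes "finite P" "finite Q" "finite Z" "card Z \<le> s" "s < card P" "s < card Q"
    and "P = Q \<Longrightarrow> Suc s < card P"
  shows "\<exists>c d. c \<in> P - Z \<and> d \<in> Q - Z \<and> c \<noteq> d"
proof (rule ccontr)
  assume no: "\<not> ?thesis"
  have "card (P - Z) > 0" "card (Q - Z) > 0"
    using diff_card_le_card_Diff[OF assms(3), of P] diff_card_le_card_Diff[OF assms(3), of Q] assms(4-6) by auto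
  then have "P - Z \<noteq> {}" "Q - Z \<noteq> {}" by (auto simp: card_gt_0_iff)
  then obtain c d where "c \<in> P - Z" "d \<in> Q - Z" by blast
  with no have s: "P - Z = {c}" "Q - Z = {c}" by blast+
  \<comment> \<open>A colour of \<open>Z\<close> outside \<open>P\<close> would leave at least two
    colours in \<open>P - Z\<close>, since \<open>s < card P\<close>.\<close>
  have "Z \<subseteq> P"
  proof (rule ccontr)
    assume "\<not> Z \<subseteq> P"
    then have "card (Z \<inter> P) < card Z" by (intro psubset_card_mono assms) auto
    moreover have "card P = card (P - Z) + card (Z \<inter> P)"
      using card_Int_Diff[OF assms(1), of Z] by (simp add: Int_commute)
    ultimately show False using s assms(4,5) by simp
  qed
  moreover have "Z \<subseteq> Q"
  proof (rule ccontr)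
    assume "\<not> Z \<subseteq> Q"
    then have "card (Z \<inter> Q) < card Z" by (intro psubset_card_mono assms) auto
    moreover have "card Q = card (Q - Z) + card (Z \<inter> Q)"
      using card_Int_Diff[OF assms(2), of Z] by (simp add: Int_commute)
    ultimately show False using s assms(4,6) by simp
  qed
  ultimately have PQ: "P = insert c Z" "Q = insert c Z" using s by blast+
  then have "card P \<le> Suc (card Z)" using assms(3) by (simp add: card_insert_if)
  then show False using PQ assms(4,7) by simp
qed

text \<open>Serves the last premise of \<open>distinct_pair\<close>, where \<open>a\<close> and
  \<open>b\<close> are colours deleted from two lists. If both deletions took effect and left the
  same set, then either \<open>A = B\<close> and \<open>a = b\<close>, or \<open>B - A\<close> is
  contained in \<open>{b}\<close>, which forces \<open>z = b\<close>.\<close>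

lemma diff_lists_distinct:
  assumes "card A = Suc s" "card B = Suc s" "A = B \<Longrightarrow> a \<noteq> b" "A \<noteq> B \<Longrightarrow> z \<in> B - A \<and> b \<noteq> z"
    and "A - {a} = B - {b}"
  shows "s < card (A - {a})"
proof (rule ccontr)
  have fin: "finite A" "finite B" using assms(1,2) card.infinite by fastforce+
  assume "\<not> ?thesis"
  then have "a \<in> A" using assms(1) by (cases "a \<in> A") auto
  have "b \<in> B" using assms(2,5) \<open>\<not> s < card (A - {a})\<close> by (cases "b \<in> B") auto
  with \<open>a \<in> A\<close> have "A = insert a (A - {a})" "B = insert b (A - {a})" using assms(5) by auto
  then show False using assms(3,4) by blast
qed

text \<open>The expression \<open>(a + k - 1) div k\<close> is \<open>a / k\<close> rounded up, the
  number of blocks of size at most \<open>k\<close> needed for \<open>a\<close> vertices.\<close>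

lemma blocks_step:
  fixes a k :: nat
  assumes "0 < k"
  shows "(a + k + k - 1) div k = Suc ((a + k - 1) div k)"
proof -
  have "a + k + k - 1 = (a + k - 1) + k" using assms by simp
  then show ?thesis using assms by (metis Suc_eq_plus1 div_add_self2 less_numeral_extra(3))
qed

lemma blocks_pos:
  fixes a k :: nat
  assumes "0 < a"
  shows "0 < k \<Longrightarrow> 1 \<le> (a + k - 1) div k"
  using assms by (simp add: Suc_leI div_greater_zero_iff)

lemma bounded_colouring_mono:
  "bounded_colouring adj L t V f \<Longrightarrow> t \<le> t' \<Longrightarrow> bounded_colouring adj L t' V f"
  unfolding bounded_colouring_def by (meson order_trans)

locale list_graph =
  fixes adj :: "'v \<Rightarrow> 'v \<Rightarrow> bool" and L :: "'v \<Rightarrow> nat set" and k :: nat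
  assumes adj_sym: "adj x y \<Longrightarrow> adj y x" and adj_irrefl: "\<not> adj x x"
    and card_L: "card (L x) = k" and k_pos: "0 < k"
begin

lemma finite_L: "finite (L x)"
  using card_L[of x] k_pos card.infinite by fastforce

text \<open>No colour is repeated inside the block \<open>S\<close>, so every colour class grows by
  at most one vertex.\<close>

lemma extend_by:
  assumes f: "bounded_colouring adj L t T f" and fin: "finite T" "finite S" and disj: "T \<inter> S = {}"
    and g: "inj_on g S" "\<And>x. x \<in> S \<Longrightarrow> g x \<in> L x"
    "\<And>x y. x \<in> S \<Longrightarrow> y \<in> T \<Longrightarrow> adj x y \<Longrightarrow> g x \<noteq> f y"
  shows "bounded_colouring adj L (Suc t) (T \<union> S) (\<lambda>x. if x \<in> S then g x else f x)" (is "bounded_colouring _ _ _ _ ?h")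
proof -
  have "card {v \<in> T \<union> S. ?h v = c} \<le> Suc t" for c
  proof -
    have "{v \<in> T \<union> S. ?h v = c} \<subseteq> {v \<in> T. f v = c} \<union> {v \<in> S. g v = c}" by auto
    then have "card {v \<in> T \<union> S. ?h v = c} \<le> card ({v \<in> T. f v = c} \<union> {v \<in> S. g v = c})"
      using fin by (intro card_mono) auto
    also have "\<dots> \<le> card {v \<in> T. f v = c} + card {v \<in> S. g v = c}" by (rule card_Un_le)
    also have "card {v \<in> T. f v = c} \<le> t" using f unfolding bounded_colouring_def by blast
    also have "card {v \<in> S. g v = c} \<le> 1"
      using g(1) by (auto simp: card_le_Suc0_iff_eq fin inj_on_def)
    finally show ?thesis by simp
  qed
  moreover have "?h v \<in> L v" if "v \<in> T \<union> S" for v using that f g(2) unfolding bounded_colouring_def by auto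
  moreover have "?h v \<noteq> ?h v'" if vv: "v \<in> T \<union> S" "v' \<in> T \<union> S" "adj v v'" for v v'
  proof (cases "v \<in> S"; cases "v' \<in> S")
    assume "v \<in> S" "v' \<in> S"
    moreover have "v \<noteq> v'" using vv(3) adj_irrefl by blast
    ultimately show ?thesis using g(1) by (simp add: inj_on_eq_iff)
  next
    assume "v \<in> S" "v' \<notin> S"
    then show ?thesis using g(3)[of v v'] vv by simp
  next
    assume "v \<notin> S" "v' \<in> S"
    then show ?thesis using g(3)[of v' v] vv adj_sym by force
  next
    assume "v \<notin> S" "v' \<notin> S"
    then show ?thesis using f vv unfolding bounded_colouring_def by simp
  qed
  ultimately show ?thesis unfolding bounded_colouring_def by blast
qed

text \<open>Applies \<open>greedy_distinct\<close> to the lists after deleting the colours of the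
  neighbours in \<open>T\<close> and an extra set \<open>E x\<close>; \<open>D x\<close> bounds the
  number of deleted colours.\<close>

lemma block_choice:
  assumes "finite S" and fin: "finite T" "\<And>x. x \<in> S \<Longrightarrow> finite (E x)"
    and D: "\<And>x. x \<in> S \<Longrightarrow> card {y\<in>T. adj x y} + card (E x) \<le> D x"
    and rank: "\<And>x. x \<in> S \<Longrightarrow> card {y\<in>S. D x \<le> D y} + D x \<le> k"
  shows "\<exists>g. inj_on g S \<and> (\<forall>x\<in>S. g x \<in> L x \<and> g x \<notin> E x \<and> (\<forall>y\<in>T. adj x y \<longrightarrow> g x \<noteq> f y))"
proof -
  let ?F = "\<lambda>x. f ` {y\<in>T. adj x y} \<union> E x"
  have "\<exists>g. inj_on g S \<and> (\<forall>x\<in>S. g x \<in> L x - ?F x)"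
  proof (rule greedy_distinct[where D = D and k = k])
    fix x assume x: "x \<in> S"
    show "finite (L x - ?F x)" using finite_L by simp
    have "card (?F x) \<le> card (f ` {y\<in>T. adj x y}) + card (E x)" by (rule card_Un_le)
    also have "\<dots> \<le> D x" using card_image_le[of "{y\<in>T. adj x y}" f] fin D[OF x] by fastforce
    finally have "card (?F x) \<le> D x" .
    moreover have "finite (?F x)" using fin x by auto
    ultimately show "k \<le> card (L x - ?F x) + D x"
      using diff_card_le_card_Diff[of "?F x" "L x"] card_L[of x] by linarith
  qed (use assms in auto)
  then obtain g where g: "inj_on g S" "\<And>x. x \<in> S \<Longrightarrow> g x \<in> L x - ?F x" by blast
  have "\<forall>x\<in>S. g x \<in> L x \<and> g x \<notin> E x \<and> (\<forall>y\<in>T. adj x y \<longrightarrow> g x \<noteq> f y)"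
  proof
    fix x assume "x \<in> S"
    from g(2)[OF this] show "g x \<in> L x \<and> g x \<notin> E x \<and> (\<forall>y\<in>T. adj x y \<longrightarrow> g x \<noteq> f y)" by blast
  qed
  with g(1) show ?thesis by blast
qed

lemma extend_block:
  assumes f: "bounded_colouring adj L t T f" and fin: "finite T" "finite S" and disj: "T \<inter> S = {}"
    and D: "\<And>x. x \<in> S \<Longrightarrow> card {y\<in>T. adj x y} \<le> D x"
    and rank: "\<And>x. x \<in> S \<Longrightarrow> card {y\<in>S. D x \<le> D y} + D x \<le> k"
  shows "\<exists>g. bounded_colouring adj L (Suc t) (T \<union> S) g"
proof -
  have "\<exists>g. inj_on g S \<and> (\<forall>x\<in>S. g x \<in> L x \<and> g x \<notin> {} \<and> (\<forall>y\<in>T. adj x y \<longrightarrow> g x \<noteq> f y))"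
    by (rule block_choice[where D = D]) (use assms in auto)
  then show ?thesis using extend_by[OF f fin disj] by blast
qed

text \<open>The Boolean \<open>b\<close> selects whether \<open>v\<close> must differ from
  \<open>z\<close> or avoid the fixed colour \<open>c\<close>. This costs one more forbidden colour
  at \<open>v\<close>; if \<open>z\<close> lies in the block itself, injectivity already separates
  it from \<open>v\<close>.\<close>

lemma extend_block_avoiding:
  assumes f: "bounded_colouring adj L t T f" and fin: "finite T" "finite S" and disj: "T \<inter> S = {}"
    and D: "\<And>x. x \<in> S \<Longrightarrow> card {y\<in>T. adj x y} + (if x = v then 1 else 0) \<le> D x"
    and rank: "\<And>x. x \<in> S \<Longrightarrow> card {y\<in>S. D x \<le> D y} + D x \<le> k"
    and v: "v \<in> S" "z \<in> T \<union> S" "z \<noteq> v"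
  shows "\<exists>g. bounded_colouring adj L (Suc t) (T \<union> S) g \<and> g v \<noteq> (if b then g z else c)"
proof -
  let ?E = "\<lambda>x. if x = v then {if b then f z else c} else {}"
  have "\<exists>g. inj_on g S \<and> (\<forall>x\<in>S. g x \<in> L x \<and> g x \<notin> ?E x \<and> (\<forall>y\<in>T. adj x y \<longrightarrow> g x \<noteq> f y))"
  proof (rule block_choice[where D = D])
    fix x assume "x \<in> S"
    then show "card {y\<in>T. adj x y} + card (?E x) \<le> D x" using D[of x] by (auto split: if_splits)
  qed (use assms in auto)
  then obtain g where g: "inj_on g S"
    "\<And>x. x \<in> S \<Longrightarrow> g x \<in> L x \<and> g x \<notin> ?E x \<and> (\<forall>y\<in>T. adj x y \<longrightarrow> g x \<noteq> f y)" by blast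
  let ?h = "\<lambda>x. if x \<in> S then g x else f x"
  have "bounded_colouring adj L (Suc t) (T \<union> S) ?h"
    by (rule extend_by[OF f fin disj]) (use g in auto)
  moreover have "?h v \<noteq> (if b then ?h z else c)"
    using g(2)[OF v(1)] v inj_onD[OF g(1), of v z] by (auto split: if_splits)
  ultimately show ?thesis by blast
qed

lemma empty_colouring: "bounded_colouring adj L 0 {} f"
  unfolding bounded_colouring_def by simp

lemma single_block:
  assumes "finite V" "card V \<le> k"
  shows "\<exists>f. bounded_colouring adj L 1 V f"
  using extend_block[OF empty_colouring, of V "\<lambda>_. 0"] assms by simp

lemma single_block_avoiding:
  assumes "finite V" "card V \<le> k" "v \<in> V" "z \<in> V" "z \<noteq> v" "2 \<le> k"
  shows "\<exists>f. bounded_colouring adj L 1 V f \<and> f v \<noteq> (if b then f z else c)"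
proof -
  have "\<exists>f. bounded_colouring adj L (Suc 0) ({} \<union> V) f \<and> f v \<noteq> (if b then f z else c)"
  proof (rule extend_block_avoiding[OF empty_colouring, where D = "\<lambda>x. if x = v then 1 else 0"])
    fix x assume "x \<in> V"
    show "card {y\<in>V. (if x = v then 1 else 0) \<le> (if y = v then 1 else 0 :: nat)} + (if x = v then 1 else 0) \<le> k"
    proof (cases "x = v")
      case True
      have "card {y\<in>V. (1::nat) \<le> (if y = v then 1 else 0)} \<le> card {v}"
        by (rule card_mono) (auto split: if_splits)
      then show ?thesis using True assms(6) by simp
    qed (use assms in simp)
  qed (use assms in auto)
  then show ?thesis by simp
qed

end

section \<open>Spiders\<close>

text \<open>Describes only the surroundings of \<open>TU\<close>, which acts as position 0 of every
  leg. The far ends of distinct legs are not joined.\<close>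

fun spider_adj :: "theta_vertex \<Rightarrow> theta_vertex \<Rightarrow> bool" where
  "spider_adj TU (TI i j) \<longleftrightarrow> j \<le> 2"
| "spider_adj (TI i j) TU \<longleftrightarrow> j \<le> 2"
| "spider_adj (TI i j) (TI i' j') \<longleftrightarrow>
     i = i' \<and> j \<noteq> j' \<and> j \<le> j' + 2 \<and> j' \<le> j + 2 \<or> i \<noteq> i' \<and> j = 1 \<and> j' = 1"
| "spider_adj _ _ \<longleftrightarrow> False"

text \<open>The vectors \<open>p\<close> and \<open>r\<close> are leg lengths;
  \<open>seg m p r\<close> is the block cut off when the spider \<open>r\<close> is shortened to
  \<open>p\<close>.\<close>

definition seg :: "nat \<Rightarrow> (nat \<Rightarrow> nat) \<Rightarrow> (nat \<Rightarrow> nat) \<Rightarrow> theta_vertex set" where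
  "seg m p r = {TI i j | i j. i < m \<and> p i < j \<and> j \<le> r i}"

definition spider :: "nat \<Rightarrow> (nat \<Rightarrow> nat) \<Rightarrow> theta_vertex set" where
  "spider m r = insert TU (seg m (\<lambda>_. 0) r)"

lemma seg_simps [simp]:
  "TI i j \<in> seg m p r \<longleftrightarrow> i < m \<and> p i < j \<and> j \<le> r i" "TU \<notin> seg m p r" "TW \<notin> seg m p r"
  by (auto simp: seg_def)

lemma spider_simps [simp]:
  "TI i j \<in> spider m r \<longleftrightarrow> i < m \<and> 0 < j \<and> j \<le> r i" "TU \<in> spider m r" "TW \<notin> spider m r"
  by (auto simp: spider_def)

lemma seg_eq: "seg m p r = (\<lambda>(i, j). TI i j) ` (SIGMA i:{..<m}. {p i<..r i})"
  by (force simp: seg_def image_iff)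

lemma finite_seg [simp]: "finite (seg m p r)"
  unfolding seg_eq by auto

lemma finite_spider [simp]: "finite (spider m r)"
  by (simp add: spider_def)

lemma card_seg: "card (seg m p r) = (\<Sum>i<m. r i - p i)"
proof -
  have "card (seg m p r) = card (SIGMA i:{..<m}. {p i<..r i})"
    unfolding seg_eq by (intro card_image) (auto simp: inj_on_def)
  then show ?thesis by simp
qed

lemma card_spider: "card (spider m r) = Suc (\<Sum>i<m. r i)"
  by (simp add: spider_def card_seg)

lemma spider_split: "\<forall>i<m. p i \<le> r i \<Longrightarrow> spider m r = spider m p \<union> seg m p r"
  by (auto simp: spider_def seg_def not_less intro: order_trans)

lemma spider_disjoint: "spider m p \<inter> seg m p r = {}"
  by (auto simp: spider_def seg_def)

lemma spider_mono: "\<forall>i<m. p i \<le> r i \<Longrightarrow> spider m p \<subseteq> spider m r"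
  by (auto simp: spider_split)

text \<open>Bounds the number of neighbours that a vertex of \<open>seg m p r\<close> has in the
  remaining spider. A first position is cut only when its leg disappears, and then it sees
  \<open>TU\<close> and the surviving first positions. Elsewhere only the distance to the cut
  matters. The value 0 at the branch vertices is a default; a count for \<open>TW\<close> is
  supplied separately.\<close>

fun legdeg :: "nat \<Rightarrow> (nat \<Rightarrow> nat) \<Rightarrow> theta_vertex \<Rightarrow> nat" where
  "legdeg m p (TI i j) = (if j = 1 then Suc (card {i'. i' < m \<and> 1 \<le> p i'})
     else if j = p i + 1 then 2 else if j = p i + 2 then 1 else 0)"
| "legdeg m p _ = 0"

lemma card_le_2: "card {a, b} \<le> 2"
  by (cases "a = b") auto

lemma legdeg:
  assumes "x \<in> seg m p r"
  shows "card {y\<in>spider m p. spider_adj x y} \<le> legdeg m p x"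
proof -
  obtain i j where x: "x = TI i j" "i < m" "p i < j" using assms by (auto simp: seg_def)
  \<comment> \<open>\<open>TU\<close> is treated as position 0 of leg \<open>i\<close>, so for
    \<open>j \<noteq> 1\<close> the neighbours are among positions \<open>j - 1\<close> and
    \<open>j - 2\<close>, as far as these are not beyond the cut.\<close>
  define pos where "pos h = (if h = 0 then TU else TI i h)" for h
  show ?thesis
  proof (cases "j = 1")
    case True
    have "{y\<in>spider m p. spider_adj x y} \<subseteq> insert TU ((\<lambda>i. TI i 1) ` {i'. i' < m \<and> 1 \<le> p i'})"
      using True x by (auto simp: spider_def seg_def)
    then have "card {y\<in>spider m p. spider_adj x y} \<le> card (insert TU ((\<lambda>i. TI i 1) ` {i'. i' < m \<and> 1 \<le> p i'}))"
      by (intro card_mono) auto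
    also have "\<dots> = Suc (card {i'. i' < m \<and> 1 \<le> p i'})"
      by (subst card_insert_disjoint) (auto intro!: card_image simp: inj_on_def)
    finally show ?thesis using True x by simp
  next
    case False
    have sub: "{y\<in>spider m p. spider_adj x y} \<subseteq> {pos h | h. h \<le> p i \<and> h < j \<and> j \<le> h + 2}"
    proof
      fix y assume y: "y \<in> {y\<in>spider m p. spider_adj x y}"
      show "y \<in> {pos h | h. h \<le> p i \<and> h < j \<and> j \<le> h + 2}"
      proof (cases y)
        case TU
        then have "y = pos 0" "j \<le> 2" using y x by (auto simp: pos_def)
        then show ?thesis using x by force
      next
        case TW
        then show ?thesis using y by simp
      next
        case (TI i' j')
        then have "y = pos j'" "j' \<le> p i" "j \<le> j' + 2" using y x False by (auto simp: pos_def)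
        then show ?thesis using x by force
      qed
    qed
    consider "j = p i + 1" | "j = p i + 2" | "j > p i + 2" using x by linarith
    then show ?thesis
    proof cases
      case 1
      have "h = p i \<or> h = p i - 1" if "h \<le> p i" "j \<le> h + 2" for h using that 1 by linarith
      with sub have "{y\<in>spider m p. spider_adj x y} \<subseteq> {pos (p i), pos (p i - 1)}" by blast
      then have "card {y\<in>spider m p. spider_adj x y} \<le> card {pos (p i), pos (p i - 1)}"
        by (intro card_mono) auto
      also have "\<dots> \<le> 2" by (rule card_le_2)
      finally show ?thesis using 1 x False by simp
    next
      case 2
      have "h = p i" if "h \<le> p i" "j \<le> h + 2" for h using that 2 by simp
      with sub have "{y\<in>spider m p. spider_adj x y} \<subseteq> {pos (p i)}" by blast
      then have "card {y\<in>spider m p. spider_adj x y} \<le> card {pos (p i)}"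
        by (intro card_mono) auto
      then show ?thesis using 2 x by simp
    next
      case 3
      then have "\<not> (h \<le> p i \<and> j \<le> h + 2)" for h by simp
      with sub have "{y\<in>spider m p. spider_adj x y} = {}" by blast
      then show ?thesis by (metis card.empty le0)
    qed
  qed
qed

text \<open>First positions in the block come from legs with \<open>p i = 0\<close>, surviving ones
  from legs with \<open>p i \<ge> 1\<close>. Hence first positions, whose \<open>legdeg\<close> is
  one more than the number of surviving ones, meet the greedy condition as soon as
  \<open>m + 1 \<le> k\<close>.\<close>

lemma card_centres:
  "card {y\<in>seg m p r. y \<in> {TI i 1 | i. True}} + card {i. i < m \<and> 1 \<le> p i} \<le> m"
proof -
  have "{y\<in>seg m p r. y \<in> {TI i 1 | i. True}} \<subseteq> (\<lambda>i. TI i 1) ` {i. i < m \<and> p i = 0}" by auto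
  then have "card {y\<in>seg m p r. y \<in> {TI i 1 | i. True}} \<le> card ((\<lambda>i. TI i 1) ` {i. i < m \<and> p i = 0})"
    by (intro card_mono) auto
  also have "\<dots> \<le> card {i. i < m \<and> p i = 0}" by (rule card_image_le) simp
  finally have "card {y\<in>seg m p r. y \<in> {TI i 1 | i. True}} + card {i. i < m \<and> 1 \<le> p i}
    \<le> card {i. i < m \<and> p i = 0} + card {i. i < m \<and> 1 \<le> p i}" by simp
  also have "\<dots> = card ({i. i < m \<and> p i = 0} \<union> {i. i < m \<and> 1 \<le> p i})"
    by (rule card_Un_disjoint[symmetric]) auto
  also have "{i. i < m \<and> p i = 0} \<union> {i. i < m \<and> 1 \<le> p i} = {..<m}" by auto
  finally show ?thesis by simp
qed

lemma legdeg_le_2: "x \<notin> {TI i 1 | i. True} \<Longrightarrow> legdeg m p x \<le> 2"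
  by (cases x) auto

section \<open>Cutting a prescribed number of vertices off the tips\<close>

lemma vector_with_sum:
  fixes h :: "nat \<Rightarrow> nat"
  assumes "K \<le> (\<Sum>i<m. h i)"
  shows "\<exists>p. (\<forall>i<m. p i \<le> h i) \<and> (\<Sum>i<m. p i) = K"
  using assms
proof (induction m arbitrary: K)
  case (Suc m)
  have "K - min K (h m) \<le> (\<Sum>i<m. h i)" using Suc.prems by auto
  from Suc.IH[OF this] obtain p where "\<forall>i<m. p i \<le> h i" "(\<Sum>i<m. p i) = K - min K (h m)" by blast
  then show ?case by (intro exI[of _ "p(m := min K (h m))"]) (auto simp: less_Suc_eq)
qed auto

text \<open>\<open>lo i\<close> is the least number of positions that leg \<open>i\<close> must
  lose; it forces several vertices of one leg into the block. The remaining lengths are chosen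
  first, at most \<open>r i - lo i\<close> each and with the right sum.\<close>

lemma cut_tips:
  fixes r lo :: "nat \<Rightarrow> nat"
  assumes "\<forall>i<m. lo i \<le> r i" "(\<Sum>i<m. lo i) \<le> K" "K \<le> (\<Sum>i<m. r i)"
  obtains p where "\<forall>i<m. p i \<le> r i" "\<forall>i<m. p i + lo i \<le> r i" "card (seg m p r) = K"
    "card (spider m p) = card (spider m r) - K"
proof -
  have "(\<Sum>i<m. r i - lo i) = (\<Sum>i<m. r i) - (\<Sum>i<m. lo i)"
    using assms(1) by (intro sum_subtractf_nat) auto
  then have "(\<Sum>i<m. r i) - K \<le> (\<Sum>i<m. r i - lo i)" using assms by linarith
  then obtain p where p: "\<forall>i<m. p i \<le> r i - lo i" "(\<Sum>i<m. p i) = (\<Sum>i<m. r i) - K"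
    using vector_with_sum by blast
  have 1: "\<forall>i<m. p i + lo i \<le> r i" using p(1) assms(1) by fastforce
  then have 2: "\<forall>i<m. p i \<le> r i" by auto
  have "(\<Sum>i<m. r i - p i) = (\<Sum>i<m. r i) - (\<Sum>i<m. p i)"
    using 2 by (intro sum_subtractf_nat) auto
  then have "card (seg m p r) = K" unfolding card_seg using p(2) assms(3) by simp
  moreover have "card (spider m p) = card (spider m r) - K" using p(2) assms(3) by (simp add: card_spider)
  ultimately show ?thesis using that 1 2 by blast
qed

locale spider_lists = list_graph adj L k
  for adj :: "theta_vertex \<Rightarrow> theta_vertex \<Rightarrow> bool" and L k +
  fixes m :: nat
  assumes m_k: "m + 2 \<le> k"
begin

text \<open>An inclusion of adjacencies suffices, as only upper bounds on degrees enter. In the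
  total graph it holds as long as at most one leg keeps its last position.\<close>

definition spiderlike :: "(nat \<Rightarrow> nat) \<Rightarrow> bool" where
  "spiderlike r \<longleftrightarrow> (\<forall>x\<in>spider m r. \<forall>y\<in>spider m r. adj x y \<longrightarrow> spider_adj x y)"

lemma spiderlike_mono: "spiderlike r \<Longrightarrow> \<forall>i<m. p i \<le> r i \<Longrightarrow> spiderlike p"
  unfolding spiderlike_def using spider_mono by blast

lemma card_adj_le:
  assumes "\<And>y. y \<in> spider m p \<Longrightarrow> adj x y \<Longrightarrow> spider_adj x y" "x \<in> seg m p r"
  shows "card {y\<in>spider m p. adj x y} \<le> legdeg m p x"
proof -
  have "card {y\<in>spider m p. adj x y} \<le> card {y\<in>spider m p. spider_adj x y}"
    by (rule card_mono) (use assms in auto)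
  with legdeg[OF assms(2)] show ?thesis by simp
qed

lemma spiderlike_card_adj_le:
  assumes "spiderlike r" "\<forall>i<m. p i \<le> r i" "x \<in> seg m p r"
  shows "card {y\<in>spider m p. adj x y} \<le> legdeg m p x"
  by (rule card_adj_le[OF _ assms(3)])
    (use assms spider_split[OF assms(2)] in \<open>auto simp: spiderlike_def\<close>)

text \<open>No leg offers three vertices here, so the outer block comes first: it consists of second
  positions of legs other than \<open>M\<close>, and exactly \<open>k\<close> vertices are left for
  the block containing \<open>TU\<close>. There \<open>TI M 1\<close> has no earlier neighbour and
  \<open>TI M 2\<close> only has the prescribed colour to avoid. \<open>TU\<close> may see up to
  \<open>m\<close> coloured vertices, but it is the only such vertex.\<close>

lemma two_level_spider:
  assumes "spiderlike r" "\<forall>i<m. r i \<le> 2" "M < m" "r M = 2" "k < card (spider m r)"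
    and z: "z \<in> spider m r" "z \<noteq> TI M 2"
  shows "\<exists>f. bounded_colouring adj L ((card (spider m r) + k - 1) div k) (spider m r) f \<and>
    f (TI M 2) \<noteq> (if b then f z else c)"
proof -
  let ?d = "{i. i < m \<and> r i = 2}"
  have "(\<Sum>i<m. r i) \<le> (\<Sum>i<m. 1 + (if r i = 2 then 1 else 0))"
    by (rule sum_mono) (use assms(2) in \<open>auto simp: le_Suc_eq numeral_2_eq_2\<close>)
  also have "\<dots> = m + (\<Sum>i<m. if r i = 2 then 1 else 0)" unfolding sum.distrib by simp
  also have "(\<Sum>i<m. if r i = 2 then 1 else 0) = card ?d"
    by (simp add: sum.If_cases Int_def)
  \<comment> \<open>There are at most \<open>m + 1 + card ?d\<close> vertices and
    \<open>m + 2 \<le> k\<close>, so the excess over \<open>k\<close> fits into the legs of length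
    two other than \<open>M\<close>.\<close>
  finally have "card (spider m r) - k \<le> card (?d - {M})"
    using assms(3,4) m_k by (simp add: card_spider)
  then obtain J where J: "J \<subseteq> ?d - {M}" "card J = card (spider m r) - k" "finite J"
    using obtain_subset_with_card_n by blast
  let ?T = "(\<lambda>i. TI i 2) ` J"
  let ?S = "spider m r - ?T"
  have T: "card ?T = card J" by (rule card_image) (auto simp: inj_on_def)
  have sub: "?T \<subseteq> spider m r" using J(1) by auto
  have "card J \<le> card ({..<m} - {M})" by (rule card_mono) (use J(1) in auto)
  then have Jm: "card J \<le> m" using assms(3) by simp
  have "\<exists>f. bounded_colouring adj L 1 ?T f"
    by (rule single_block) (use J(3) T Jm m_k in auto)
  then obtain f where f: "bounded_colouring adj L 1 ?T f" ..
  let ?D = "\<lambda>x. if x = TU then m else if x = TI M 1 then 0 else 1 :: nat"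
  have cS: "card ?S = k"
    using card_Diff_subset[OF _ sub] J(3) T J(2) assms(5) by simp
  have adj: "spider_adj x y" if "x \<in> ?S" "y \<in> ?T" "adj x y" for x y
    using that assms(1) sub unfolding spiderlike_def by blast
  have "\<exists>g. bounded_colouring adj L (Suc 1) (?T \<union> ?S) g \<and> g (TI M 2) \<noteq> (if b then g z else c)"
  proof (rule extend_block_avoiding[OF f, where D = ?D])
    fix x assume x: "x \<in> ?S"
    show "card {y\<in>?T. adj x y} + (if x = TI M 2 then 1 else 0) \<le> ?D x"
    proof (cases x)
      case TU
      have "card {y\<in>?T. adj x y} \<le> card ?T" by (rule card_mono) (use J(3) in auto)
      then show ?thesis using TU T Jm by simp
    next
      case TW
      then show ?thesis using x by simp
    next
      case (TI i j)
      then consider "j = 1" | "j = 2" "i \<notin> J" using x assms(2) by (force simp: le_Suc_eq numeral_2_eq_2)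
      then show ?thesis
      proof cases
        case 1
        have "{y\<in>?T. adj x y} \<subseteq> (if i = M then {} else {TI i 2})"
        proof
          fix y assume "y \<in> {y\<in>?T. adj x y}"
          then obtain i' where i': "i' \<in> J" "y = TI i' 2" "spider_adj x y" using adj[OF x] by blast
          then have "i' = i" using TI 1 by simp
          with i' J(1) show "y \<in> (if i = M then {} else {TI i 2})" by auto
        qed
        then have "card {y\<in>?T. adj x y} \<le> card (if i = M then {} else {TI i 2})"
          by (intro card_mono) auto
        then show ?thesis using TI 1 by auto
      next
        case 2
        have "\<not> adj x y" if "y \<in> ?T" for y
        proof
          assume "adj x y"
          with that obtain i' where "i' \<in> J" "y = TI i' 2" "spider_adj x y" using adj[OF x] by blast
          then show False using TI 2 by auto
        qed
        then have "card {y\<in>?T. adj x y} = 0" by (metis (mono_tags, lifting) card.empty empty_Collect_eq)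
        then show ?thesis unfolding \<open>card {y\<in>?T. adj x y} = 0\<close> using TI 2 by simp
      qed
    qed
    show "card {y\<in>?S. ?D x \<le> ?D y} + ?D x \<le> k"
    proof (rule rank_condition[where p = "TI M 1" and q = "TI M 2" and U = "{TU}"])
      fix x assume "x \<in> ?S" "3 \<le> ?D x"
      then have "x = TU" by (auto split: if_splits)
      moreover have "card {y\<in>?S. ?D x \<le> ?D y \<and> y \<in> {TU}} \<le> card {TU}" by (rule card_mono) auto
      ultimately show "card {y\<in>?S. ?D x \<le> ?D y \<and> y \<in> {TU}} + ?D x \<le> k" using m_k by simp
    qed (use x cS assms(3,4) J(1) in auto)
  qed (use J z assms(3,4) in auto)
  moreover have "?T \<union> ?S = spider m r" using sub by blast
  moreover have "Suc 1 \<le> (card (spider m r) + k - 1) div k"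
  proof -
    have e: "card (spider m r) = card J + k" "0 < card J" using J(2) assms(5) by auto
    show ?thesis unfolding e(1) using blocks_step[OF k_pos, of "card J"] blocks_pos[OF e(2) k_pos] by simp
  qed
  ultimately show ?thesis using bounded_colouring_mono by metis
qed

text \<open>At least three vertices are cut from leg \<open>e\<close>. The outermost one has no
  remaining neighbour and the one before it at most one; \<open>card_centres\<close> handles the
  first positions, and all other vertices have at most two remaining neighbours.\<close>

lemma legdeg_rank:
  assumes "card (seg m p r) \<le> k" "e < m" "p e + 3 \<le> r e" and x: "x \<in> seg m p r"
  shows "card {y\<in>seg m p r. legdeg m p x \<le> legdeg m p y} + legdeg m p x \<le> k"
proof (rule rank_condition[where p = "TI e (r e)" and q = "TI e (r e - 1)" and U = "{TI i 1 | i. True}"])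
  let ?U = "{TI i 1 | i. True}"
  fix x assume x: "x \<in> seg m p r" "3 \<le> legdeg m p x"
  then obtain i where "x = TI i 1" using legdeg_le_2[of x m p] by fastforce
  then have D: "legdeg m p x = Suc (card {i. i < m \<and> 1 \<le> p i})" by simp
  have "card {y\<in>seg m p r. legdeg m p x \<le> legdeg m p y \<and> y \<in> ?U} \<le> card {y\<in>seg m p r. y \<in> ?U}"
    by (rule card_mono) auto
  then show "card {y\<in>seg m p r. legdeg m p x \<le> legdeg m p y \<and> y \<in> ?U} + legdeg m p x \<le> k"
    using card_centres[of m p r] D m_k by linarith
qed (use assms legdeg_le_2 in auto)

text \<open>Induction on the number of vertices. A full block is cut so that it contains three
  vertices of a leg of length at least three; when no such leg exists,
  \<open>two_level_spider\<close> finishes.\<close>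

lemma spider_colouring:
  assumes "spiderlike r"
  shows "\<exists>f. bounded_colouring adj L ((card (spider m r) + k - 1) div k) (spider m r) f"
  using assms
proof (induction "card (spider m r)" arbitrary: r rule: less_induct)
  case less
  show ?case
  proof (cases "card (spider m r) \<le> k")
    case True
    have "1 \<le> (card (spider m r) + k - 1) div k"
      by (rule blocks_pos) (use k_pos card_spider in auto)
    then show ?thesis using single_block[OF finite_spider True] bounded_colouring_mono by metis
  next
    case big: False
    then have sum: "k \<le> (\<Sum>i<m. r i)" by (simp add: card_spider)
    show ?thesis
    proof (cases "\<exists>e<m. 3 \<le> r e")
      case True
      then obtain e where e: "e < m" "3 \<le> r e" by blast
      obtain p where p: "\<forall>i<m. p i \<le> r i" "\<forall>i<m. p i + (if i = e then 3 else 0) \<le> r i"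
        "card (seg m p r) = k" "card (spider m p) = card (spider m r) - k"
      proof (rule cut_tips[where m = m and lo = "\<lambda>i. if i = e then 3 else 0" and r = r and K = k])
        show "(\<Sum>i<m. if i = e then 3 else 0) \<le> k" using e m_k by (simp add: sum.delta)
      qed (use e sum in auto)
      have "\<exists>f. bounded_colouring adj L ((card (spider m p) + k - 1) div k) (spider m p) f"
        by (rule less.hyps) (use p(4) big k_pos spiderlike_mono[OF less.prems p(1)] in auto)
      then obtain f where f: "bounded_colouring adj L ((card (spider m p) + k - 1) div k) (spider m p) f" ..
      have "\<exists>g. bounded_colouring adj L (Suc ((card (spider m p) + k - 1) div k)) (spider m p \<union> seg m p r) g"
      proof (rule extend_block[OF f, where D = "legdeg m p"])
        fix x assume "x \<in> seg m p r"
        then show "card {y\<in>spider m p. adj x y} \<le> legdeg m p x"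
          using spiderlike_card_adj_le less.prems p(1) by blast
        show "card {y\<in>seg m p r. legdeg m p x \<le> legdeg m p y} + legdeg m p x \<le> k"
          by (rule legdeg_rank[where e = e]) (use p e \<open>x \<in> seg m p r\<close> in auto)
      qed (use spider_disjoint in auto)
      moreover have "card (spider m r) = card (spider m p) + k" using p(4) big by simp
      ultimately show ?thesis using blocks_step[OF k_pos] spider_split[OF p(1)] by simp
    next
      case False
      \<comment> \<open>Legs of length at most one would give at most \<open>m + 1\<close> vertices,
        fewer than \<open>k\<close>.\<close>
      have "\<exists>M<m. r M = 2"
      proof (rule ccontr)
        assume "\<not> ?thesis"
        with False have "\<forall>i<m. r i \<le> 1" by (force simp: not_le)
        then have "(\<Sum>i<m. r i) \<le> (\<Sum>i<m. 1)" by (intro sum_mono) auto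
        then show False using sum m_k by simp
      qed
      then obtain M where "M < m" "r M = 2" by blast
      moreover have "\<forall>i<m. r i \<le> 2" using False by (force simp: not_le)
      \<comment> \<open>\<open>TU\<close> merely instantiates \<open>z\<close>; the statement on the
        avoided colour is dropped.\<close>
      ultimately show ?thesis
        using two_level_spider[of r M TU] less.prems big by (metis not_le spider_simps(2) theta_vertex.distinct(3))
    qed
  qed
qed

text \<open>The tip of leg \<open>M\<close> lies in the last block, where the colour to avoid adds
  one to its count; everything else is coloured by \<open>spider_colouring\<close>. The count
  \<open>D\<close> enters \<open>rank\<close> through an equation so that it can stay folded
  there.\<close>

lemma spider_avoiding_step:
  assumes "spiderlike r" "\<forall>i<m. p i \<le> r i" "card (seg m p r) = k" "k < card (spider m r)"
    and p: "card (spider m p) = card (spider m r) - k"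
    and M: "M < m" "2 \<le> r M" "p M < r M" and z: "z \<in> spider m r" "z \<noteq> TI M (r M)"
    and rank: "\<And>x D. x \<in> seg m p r \<Longrightarrow> D = (\<lambda>x. legdeg m p x + (if x = TI M (r M) then 1 else 0)) \<Longrightarrow>
      card {y\<in>seg m p r. D x \<le> D y} + D x \<le> k"
  shows "\<exists>f. bounded_colouring adj L ((card (spider m r) + k - 1) div k) (spider m r) f \<and>
    f (TI M (r M)) \<noteq> (if b then f z else c)"
proof -
  obtain f where f: "bounded_colouring adj L ((card (spider m p) + k - 1) div k) (spider m p) f"
    using spider_colouring[OF spiderlike_mono[OF assms(1,2)]] by blast
  have "\<exists>g. bounded_colouring adj L (Suc ((card (spider m p) + k - 1) div k)) (spider m p \<union> seg m p r) g \<and>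
    g (TI M (r M)) \<noteq> (if b then g z else c)"
  proof (rule extend_block_avoiding[OF f, where D = "\<lambda>x. legdeg m p x + (if x = TI M (r M) then 1 else 0)"])
    fix x assume x: "x \<in> seg m p r"
    show "card {y\<in>spider m p. adj x y} + (if x = TI M (r M) then 1 else 0)
      \<le> legdeg m p x + (if x = TI M (r M) then 1 else 0)"
      using spiderlike_card_adj_le[OF assms(1,2) x] by simp
  qed (use rank spider_disjoint M z spider_split[OF assms(2)] in auto)
  moreover have "card (spider m r) = card (spider m p) + k" using p assms(4) by simp
  ultimately show ?thesis using blocks_step[OF k_pos] spider_split[OF assms(2)] by simp
qed

text \<open>If leg \<open>M\<close> has length at least four, four of its vertices are cut: the one
  before the tip has count 0, and the tip has count 1 because of the avoided colour. With length
  three the vertex before the tip is too close to the cut. With length two, another leg supplies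
  three vertices, or \<open>two_level_spider\<close> applies.\<close>

lemma spider_avoiding:
  assumes "spiderlike r" "4 \<le> k" "M < m" "2 \<le> r M" "r M \<noteq> 3" 
    and z: "z \<in> spider m r" "z \<noteq> TI M (r M)"
  shows "\<exists>f. bounded_colouring adj L ((card (spider m r) + k - 1) div k) (spider m r) f \<and>
    f (TI M (r M)) \<noteq> (if b then f z else c)"
proof (cases "card (spider m r) \<le> k")
  case True
  have "1 \<le> (card (spider m r) + k - 1) div k"
    by (rule blocks_pos) (use k_pos card_spider in auto)
  moreover have "\<exists>f. bounded_colouring adj L 1 (spider m r) f \<and> f (TI M (r M)) \<noteq> (if b then f z else c)"
    by (rule single_block_avoiding) (use True assms in auto)
  ultimately show ?thesis using bounded_colouring_mono by metis
next
  case big: False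
  then have sum: "k \<le> (\<Sum>i<m. r i)" by (simp add: card_spider)
  let ?C = "{TI i 1 | i. True}" let ?y = "TI M (r M)"
  have centre: "x \<in> ?C \<Longrightarrow> legdeg m p x = Suc (card {i. i < m \<and> 1 \<le> p i})" for x p by auto
  consider "4 \<le> r M" | e where "r M = 2" "e < m" "e \<noteq> M" "3 \<le> r e" | "r M = 2" "\<forall>i<m. r i \<le> 2"
  proof -
    have "4 \<le> r M \<or> r M = 2" using assms(4,5) by linarith
    moreover have "r i \<le> 2" if "r M = 2" "\<not> (\<exists>e<m. e \<noteq> M \<and> 3 \<le> r e)" "i < m" for i
      using that by (cases "i = M") (auto simp: not_le)
    ultimately show ?thesis using that by blast
  qed
  then show ?thesis
  proof cases
    case 1
    obtain p where p: "\<forall>i<m. p i \<le> r i" "\<forall>i<m. p i + (if i = M then 4 else 0) \<le> r i"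
      "card (seg m p r) = k" "card (spider m p) = card (spider m r) - k"
    proof (rule cut_tips[where m = m and lo = "\<lambda>i. if i = M then 4 else 0" and r = r and K = k])
      show "(\<Sum>i<m. if i = M then 4 else 0) \<le> k" using assms(2,3) by (simp add: sum.delta)
    qed (use 1 sum in auto)
    have pM: "p M + 4 \<le> r M" using p(2) assms(3) by auto
    show ?thesis
    proof (rule spider_avoiding_step[OF assms(1) p(1,3) _ p(4) assms(3,4) _ z])
      fix x D assume x: "x \<in> seg m p r" and D: "D = (\<lambda>x. legdeg m p x + (if x = ?y then 1 else 0))"
      show "card {y\<in>seg m p r. D x \<le> D y} + D x \<le> k"
      proof (rule rank_condition[where p = "TI M (r M - 1)" and q = ?y and U = ?C])
        fix x assume "x \<in> seg m p r" "x \<notin> ?C"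
        then show "D x \<le> 2" unfolding D using legdeg_le_2[of x m p] pM by auto
      next
        fix x assume x: "x \<in> seg m p r" "3 \<le> D x"
        have "x \<in> ?C"
        proof (rule ccontr)
          assume "x \<notin> ?C"
          then show False using x(2) legdeg_le_2[of x m p] pM unfolding D by (auto split: if_splits)
        qed
        moreover have "x \<noteq> ?y" using \<open>x \<in> ?C\<close> pM by auto
        ultimately have "D x = Suc (card {i. i < m \<and> 1 \<le> p i})" unfolding D using centre by simp
        moreover have "card {y\<in>seg m p r. D x \<le> D y \<and> y \<in> ?C} \<le> card {y\<in>seg m p r. y \<in> ?C}"
          by (rule card_mono) auto
        ultimately show "card {y\<in>seg m p r. D x \<le> D y \<and> y \<in> ?C} + D x \<le> k"
          using card_centres[of m p r] m_k by linarith
      qed (use x p(3) assms(3) pM in \<open>auto simp: D\<close>)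
    qed (use big pM in auto)
  next
    case (2 e)
    \<comment> \<open>Three vertices of leg \<open>e\<close> make the greedy order work, and one of
      leg \<open>M\<close> puts its tip into the block.\<close>
    let ?lo = "\<lambda>i. (if i = e then 3 else 0) + (if i = M then 1 else 0) :: nat"
    obtain p where p: "\<forall>i<m. p i \<le> r i" "\<forall>i<m. p i + ?lo i \<le> r i"
      "card (seg m p r) = k" "card (spider m p) = card (spider m r) - k"
    proof (rule cut_tips[where m = m and lo = ?lo and r = r and K = k])
      show "(\<Sum>i<m. ?lo i) \<le> k" unfolding sum.distrib using assms(2,3) 2 by (simp add: sum.delta)
    qed (use 2 sum in auto)
    have pe: "p e + 3 \<le> r e" "p M + 1 \<le> r M" using p(2) assms(3) 2 by (auto dest: spec[of _ e] spec[of _ M])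
    show ?thesis
    proof (rule spider_avoiding_step[OF assms(1) p(1,3) _ p(4) assms(3,4) _ z])
      fix x D assume x: "x \<in> seg m p r" and D: "D = (\<lambda>x. legdeg m p x + (if x = ?y then 1 else 0))"
      show "card {y\<in>seg m p r. D x \<le> D y} + D x \<le> k"
      proof (rule rank_condition[where p = "TI e (r e)" and q = "TI e (r e - 1)" and U = "insert ?y ?C"])
        fix x assume "x \<in> seg m p r" "x \<notin> insert ?y ?C"
        then show "D x \<le> 2" unfolding D using legdeg_le_2[of x m p] by auto
      next
        fix x assume x: "x \<in> seg m p r" "3 \<le> D x"
        let ?c = "card {i. i < m \<and> 1 \<le> p i}"
        have y3: "D ?y \<le> 3" unfolding D using 2 by auto
        have C: "D z = Suc ?c" if "z \<in> ?C" for z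
        proof -
          have "z \<noteq> ?y" using that 2 by auto
          then show ?thesis unfolding D using centre[OF that] by simp
        qed
        have all: "card {y\<in>seg m p r. D x \<le> D y \<and> y \<in> insert ?y ?C} \<le> Suc (card {y\<in>seg m p r. y \<in> ?C})"
        proof -
          have "card {y\<in>seg m p r. D x \<le> D y \<and> y \<in> insert ?y ?C} \<le> card (insert ?y {y\<in>seg m p r. y \<in> ?C})"
            by (rule card_mono) auto
          also have "\<dots> \<le> Suc (card {y\<in>seg m p r. y \<in> ?C})" by (simp add: card_insert_if)
          finally show ?thesis .
        qed
        \<comment> \<open>If \<open>D x\<close> does not exceed the count of first positions, the
          tip \<open>?y\<close> is at most one further vertex and \<open>m + 2 \<le> k\<close>
          suffices. Otherwise \<open>x\<close> is the tip, has count 3 and stands alone.\<close>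
        show "card {y\<in>seg m p r. D x \<le> D y \<and> y \<in> insert ?y ?C} + D x \<le> k"
        proof (cases "D x \<le> Suc ?c")
          case True
          then show ?thesis using all card_centres[of m p r] m_k by linarith
        next
          case False
          have "x \<in> insert ?y ?C"
          proof (rule ccontr)
            assume "x \<notin> insert ?y ?C"
            then show False using x(2) legdeg_le_2[of x m p] unfolding D by auto
          qed
          then have "x = ?y" using C[of x] False by auto
          then have "D x = 3" using y3 x(2) by simp
          moreover have "{y\<in>seg m p r. D x \<le> D y \<and> y \<in> insert ?y ?C} \<subseteq> {?y}"
            using C False by auto
          then have "card {y\<in>seg m p r. D x \<le> D y \<and> y \<in> insert ?y ?C} \<le> 1"
            using card_mono[of "{?y}"] by fastforce
          ultimately show ?thesis using assms(2) by simp
        qed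
      next
        have "p e < r e - 1" "r e - 1 \<noteq> p e + 1" "r e - 1 \<noteq> 1" "r e \<noteq> 1" "r e \<noteq> p e + 1" "r e \<noteq> p e + 2" using pe by linarith+
        moreover have "TI e (r e) \<noteq> ?y" "TI e (r e - 1) \<noteq> ?y" using 2 by auto
        ultimately show "D (TI e (r e)) = 0" "D (TI e (r e - 1)) \<le> 1" unfolding D by simp_all
        show "TI e (r e) \<in> seg m p r" "TI e (r e - 1) \<in> seg m p r" "TI e (r e) \<noteq> TI e (r e - 1)"
          using 2(2) pe by auto
      qed (use x p(3) in auto)
    qed (use big pe in auto)
  next
    case 3
    then show ?thesis using two_level_spider[of r M z] assms big by (metis not_le)
  qed
qed

end

section \<open>Blocks around the second branch vertex\<close>

text \<open>\<open>TU\<close> is position 0 and \<open>TW\<close> position \<open>n i + 1\<close> of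
  leg \<open>i\<close>, whence the condition \<open>n i \<le> j + 1\<close>. A leg with
  \<open>n i = 1\<close> is a single edge joining the branch vertices.\<close>

fun theta_adj :: "nat \<Rightarrow> (nat \<Rightarrow> nat) \<Rightarrow> theta_vertex \<Rightarrow> theta_vertex \<Rightarrow> bool" where
  "theta_adj m n TU TU \<longleftrightarrow> False"
| "theta_adj m n TW TW \<longleftrightarrow> False"
| "theta_adj m n TU TW \<longleftrightarrow> (\<exists>i<m. n i = 1)"
| "theta_adj m n TW TU \<longleftrightarrow> (\<exists>i<m. n i = 1)"
| "theta_adj m n TU (TI i j) \<longleftrightarrow> j \<le> 2"
| "theta_adj m n (TI i j) TU \<longleftrightarrow> j \<le> 2"
| "theta_adj m n TW (TI i j) \<longleftrightarrow> n i \<le> j + 1"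
| "theta_adj m n (TI i j) TW \<longleftrightarrow> n i \<le> j + 1"
| "theta_adj m n (TI i j) (TI i' j') \<longleftrightarrow>
     i = i' \<and> j \<noteq> j' \<and> j \<le> j' + 2 \<and> j' \<le> j + 2 \<or>
     i \<noteq> i' \<and> (j = 1 \<and> j' = 1 \<or> j = n i \<and> j' = n i')"

lemma theta_adj_sym: "theta_adj m n x y \<Longrightarrow> theta_adj m n y x"
  by (cases x; cases y) auto

lemma theta_adj_irrefl: "\<not> theta_adj m n x x"
  by (cases x) auto

locale theta_lists =
  fixes m :: nat and n :: "nat \<Rightarrow> nat" and L :: "theta_vertex \<Rightarrow> nat set" and k :: nat
  assumes n_pos: "i < m \<Longrightarrow> 1 \<le> n i" and card_lists: "card (L x) = k" and m_le_k: "m + 2 \<le> k"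
begin

sublocale spider_lists "theta_adj m n" L k m
  using theta_adj_sym theta_adj_irrefl card_lists m_le_k by unfold_locales auto

definition verts :: "theta_vertex set" where "verts = insert TW (spider m n)"

definition colourable :: bool where
  "colourable \<longleftrightarrow> (\<exists>f. bounded_colouring (theta_adj m n) L ((card verts + k - 1) div k) verts f)"

lemma finite_verts [simp]: "finite verts"
  by (simp add: verts_def)

lemma card_verts: "card verts = 2 + (\<Sum>i<m. n i)"
  by (simp add: verts_def card_spider)

section \<open>Colouring all vertices, with \<open>TW\<close> in the last block\<close>

lemma small_colourable:
  assumes "card verts \<le> k"
  shows colourable
proof -
  have "1 \<le> (card verts + k - 1) div k" by (rule blocks_pos) (use k_pos card_verts in auto)
  moreover obtain f where "bounded_colouring (theta_adj m n) L 1 verts f"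
    using single_block[OF finite_verts assms] ..
  ultimately show ?thesis unfolding colourable_def by (intro exI[of _ f]) (rule bounded_colouring_mono)
qed

text \<open>Without \<open>TW\<close>, the only adjacencies not described around \<open>TU\<close>
  are those between last positions of distinct legs, and the last premise excludes them.\<close>

lemma adj_spider_adj:
  assumes "x \<in> spider m n" "y \<in> spider m n" "theta_adj m n x y"
    and "\<And>i i'. x = TI i (n i) \<Longrightarrow> y = TI i' (n i') \<Longrightarrow> i = i'"
  shows "spider_adj x y"
proof (cases x)
  case TU
  then show ?thesis using assms(2,3) by (cases y) auto
next
  case TW
  then show ?thesis using assms(1) by simp
next
  case x: (TI i j)
  show ?thesis
  proof (cases y)
    case TU
    then show ?thesis using assms(3) x by simp
  next
    case TW
    then show ?thesis using assms(2) by simp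
  next
    case y: (TI i' j')
    have "j = n i \<Longrightarrow> j' = n i' \<Longrightarrow> i = i'" using assms(4)[of i i'] unfolding x y by blast
    then show ?thesis using assms(3) unfolding x y theta_adj.simps spider_adj.simps by blast
  qed
qed

text \<open>The last block consists of \<open>TW\<close> and \<open>k - 1\<close> tip vertices, at
  least one from each leg. All last positions then lie in the block, so \<open>legdeg\<close> still
  counts the remaining neighbours of its leg vertices; \<open>d\<close> bounds those of
  \<open>TW\<close>.\<close>

lemma top_step:
  assumes p: "\<forall>i<m. p i < n i" "card (seg m p n) = k - 1" "k < card verts"
    and d: "card {y\<in>spider m p. theta_adj m n TW y} \<le> d"
    and rank: "\<And>x D. x \<in> insert TW (seg m p n) \<Longrightarrow> D = (\<lambda>x. legdeg m p x + (if x = TW then d else 0)) \<Longrightarrow>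
      card {y\<in>insert TW (seg m p n). D x \<le> D y} + D x \<le> k"
  shows colourable
proof -
  have p': "\<forall>i<m. p i \<le> n i" using p(1) by auto
  have sub: "spider m p \<subseteq> spider m n" "seg m p n \<subseteq> spider m n" using spider_split[OF p'] by auto
  have adj: "spider_adj x y" if "x \<in> spider m n" "y \<in> spider m p" "theta_adj m n x y" for x y
  proof (rule adj_spider_adj[OF that(1) _ that(3)])
    show "y \<in> spider m n" using that(2) sub by blast
    fix i i' assume "y = TI i' (n i')"
    then have "i' < m" "n i' \<le> p i'" using that(2) by simp_all
    then show "i = i'" using p(1) by (auto dest: leD)
  qed
  then have "spiderlike p" unfolding spiderlike_def using sub by blast
  then obtain f where f: "bounded_colouring (theta_adj m n) L ((card (spider m p) + k - 1) div k) (spider m p) f"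
    using spider_colouring by blast
  let ?D = "\<lambda>x. legdeg m p x + (if x = TW then d else 0)"
  have "\<exists>g. bounded_colouring (theta_adj m n) L (Suc ((card (spider m p) + k - 1) div k))
    (spider m p \<union> insert TW (seg m p n)) g"
  proof (rule extend_block[OF f, where D = ?D])
    fix x assume x: "x \<in> insert TW (seg m p n)"
    show "card {y\<in>spider m p. theta_adj m n x y} \<le> ?D x"
    proof (cases "x = TW")
      case False
      then have "x \<in> seg m p n" using x by simp
      then have "card {y\<in>spider m p. theta_adj m n x y} \<le> legdeg m p x"
        using card_adj_le[of p x n] adj sub by blast
      then show ?thesis by simp
    qed (use d in simp)
    show "card {y\<in>insert TW (seg m p n). ?D x \<le> ?D y} + ?D x \<le> k" using rank[OF x] by blast
  qed (use spider_disjoint in auto)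
  moreover have "spider m p \<union> insert TW (seg m p n) = verts"
    using spider_split[OF p'] by (auto simp: verts_def)
  moreover have "card verts = card (spider m p) + k"
  proof -
    have "card (spider m n) = card (spider m p) + card (seg m p n)"
      unfolding spider_split[OF p'] by (rule card_Un_disjoint) (use spider_disjoint in auto)
    then show ?thesis using p(2) k_pos by (simp add: verts_def)
  qed
  ultimately show ?thesis unfolding colourable_def using blocks_step[OF k_pos] by metis
qed

text \<open>The block of \<open>TW\<close> takes \<open>k - 1 \<ge> 2\<close> positions, among them
  both neighbours of \<open>TW\<close>. So \<open>TW\<close> has count 0, the last position at most
  1, and all others at most 2.\<close>

lemma path_colourable:
  assumes "m = 1"
  shows colourable
proof (cases "card verts \<le> k")
  case True
  then show ?thesis by (rule small_colourable)
next
  case False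
  then have "k < 2 + (\<Sum>i<m. n i)" by (simp add: card_verts)
  then have n0: "k \<le> n 0 + 1" using assms by simp
  let ?p = "\<lambda>_. n 0 - (k - 1)"
  have p: "?p 0 + 2 \<le> n 0" using n0 m_k assms by simp
  show ?thesis
  proof (rule top_step[where p = ?p and d = 0])
    show "card (seg m ?p n) = k - 1" using n0 assms m_k by (simp add: card_seg)
    have "\<not> theta_adj m n TW y" if "y \<in> spider m ?p" for y
      using that p assms by (cases y) auto
    then show "card {y\<in>spider m ?p. theta_adj m n TW y} \<le> 0" by (simp add: card_eq_0_iff)
    fix x D assume x: "x \<in> insert TW (seg m ?p n)" and D: "D = (\<lambda>x. legdeg m ?p x + (if x = TW then 0 else 0))"
    have D2: "D x \<le> 2" for x
    proof (cases x)
      case (TI i j)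
      have "card {i'. i' < m \<and> 1 \<le> n 0 - (k - 1)} \<le> card {..<m}" by (rule card_mono) auto
      then show ?thesis using TI assms unfolding D by auto
    qed (simp_all add: D)
    show "card {y\<in>insert TW (seg m ?p n). D x \<le> D y} + D x \<le> k"
    proof (rule rank_condition[where p = TW and q = "TI 0 (n 0)" and U = "{}"])
      fix x assume "3 \<le> D x" then show "card {y \<in> insert TW (seg m ?p n). D x \<le> D y \<and> y \<in> {}} + D x \<le> k"
        using D2[of x] by simp
    next
      have "n 0 \<noteq> 1" "n 0 \<noteq> ?p 0 + 1" using p by linarith+
      then show "D (TI 0 (n 0)) \<le> 1" unfolding D by simp
      show "card (insert TW (seg m ?p n)) \<le> k" using n0 assms m_k by (simp add: card_seg)
      show "TI 0 (n 0) \<in> insert TW (seg m ?p n)" using p assms by auto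
    qed (use D2 x in \<open>auto simp: D\<close>)
  qed (use p assms False in auto)
qed

text \<open>One position of each leg and two more of leg \<open>M\<close> take \<open>m + 2\<close>
  of the \<open>k - 1\<close> places besides \<open>TW\<close>, which is where
  \<open>m + 3 \<le> k\<close> enters. \<open>TW\<close> then keeps at most one neighbour for each
  leg other than \<open>M\<close>, possibly \<open>TU\<close>.\<close>

lemma slack_colourable:
  assumes "m + 3 \<le> k" "M < m" "3 \<le> n M" "2 \<le> m"
  shows colourable
proof (cases "card verts \<le> k")
  case True
  then show ?thesis by (rule small_colourable)
next
  case False
  let ?lo = "\<lambda>i. 1 + (if i = M then 2 else 0) :: nat"
  obtain p where p: "\<forall>i<m. p i \<le> n i" "\<forall>i<m. p i + ?lo i \<le> n i" "card (seg m p n) = k - 1"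
  proof (rule cut_tips[where m = m and lo = ?lo and r = n and K = "k - 1"])
    show "(\<Sum>i<m. ?lo i) \<le> k - 1" unfolding sum.distrib using assms by (simp add: sum.delta)
    show "\<forall>i<m. ?lo i \<le> n i" using assms(3) n_pos by auto
    show "k - 1 \<le> sum n {..<m}" using False by (simp add: card_verts)
  qed auto
  have pM: "p M + 3 \<le> n M" using p(2) assms(2) by auto
  have p1: "p i < n i" if "i < m" for i using p(2) that by (auto dest: spec[of _ i])
  let ?C = "{TI i 1 | i. True}"
  show ?thesis
  proof (rule top_step[where p = p and d = "m - 1"])
    let ?pos = "\<lambda>i. if n i = 1 then TU else TI i (n i - 1)"
    have "{y\<in>spider m p. theta_adj m n TW y} \<subseteq> ?pos ` ({..<m} - {M})"
    proof
      fix y assume y: "y \<in> {y\<in>spider m p. theta_adj m n TW y}"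
      show "y \<in> ?pos ` ({..<m} - {M})"
      proof (cases y)
        case TU
        then show ?thesis using y assms(3) by (auto simp: image_iff intro: bexI)
      next
        case (TI i j)
        then have "i < m" "j \<le> p i" "n i \<le> j + 1" "0 < j" using y by auto
        then have "j = n i - 1" "n i \<noteq> 1" "i \<noteq> M" using p1[of i] pM by auto
        then show ?thesis using TI \<open>i < m\<close> by (auto simp: image_iff intro!: bexI[of _ i])
      qed (use y in auto)
    qed
    then have "card {y\<in>spider m p. theta_adj m n TW y} \<le> card (?pos ` ({..<m} - {M}))"
      by (intro card_mono) auto
    also have "\<dots> \<le> card ({..<m} - {M})" by (rule card_image_le) simp
    finally show "card {y\<in>spider m p. theta_adj m n TW y} \<le> m - 1" using assms(2) by simp
    fix x D assume x: "x \<in> insert TW (seg m p n)"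
      and D: "D = (\<lambda>x. legdeg m p x + (if x = TW then m - 1 else 0))"
    show "card {y\<in>insert TW (seg m p n). D x \<le> D y} + D x \<le> k"
    proof (rule rank_condition[where p = "TI M (n M)" and q = "TI M (n M - 1)" and U = "insert TW ?C"])
      fix x assume "x \<in> insert TW (seg m p n)" "x \<notin> insert TW ?C"
      then show "D x \<le> 2" unfolding D using legdeg_le_2[of x m p] by auto
    next
      fix x assume x: "x \<in> insert TW (seg m p n)" "3 \<le> D x"
      let ?c = "card {i. i < m \<and> 1 \<le> p i}"
      have C: "D z = Suc ?c" if "z \<in> ?C" for z using that unfolding D by auto
      have W: "D TW = m - 1" unfolding D by simp
      have all: "card {y\<in>insert TW (seg m p n). D x \<le> D y \<and> y \<in> insert TW ?C}
        \<le> Suc (card {y\<in>seg m p n. y \<in> ?C})"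
      proof -
        have "card {y\<in>insert TW (seg m p n). D x \<le> D y \<and> y \<in> insert TW ?C}
          \<le> card (insert TW {y\<in>seg m p n. y \<in> ?C})" by (rule card_mono) auto
        also have "\<dots> \<le> Suc (card {y\<in>seg m p n. y \<in> ?C})" by (simp add: card_insert_if)
        finally show ?thesis .
      qed
      \<comment> \<open>If \<open>D x\<close> does not exceed the count of first positions,
        \<open>TW\<close> is at most one further vertex. Otherwise \<open>x\<close> is
        \<open>TW\<close>, and no first position has such a large count.\<close>
      show "card {y\<in>insert TW (seg m p n). D x \<le> D y \<and> y \<in> insert TW ?C} + D x \<le> k"
      proof (cases "D x \<le> Suc ?c")
        case True
        then show ?thesis using all card_centres[of m p n] m_k by linarith
      next
        case False
        have "x \<in> insert TW ?C"
        proof (rule ccontr)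
          assume "x \<notin> insert TW ?C"
          then show False using x(2) legdeg_le_2[of x m p] unfolding D by auto
        qed
        then have "x = TW" using C[of x] False by auto
        then have "D x = m - 1" using W by simp
        moreover have "{y\<in>insert TW (seg m p n). D x \<le> D y \<and> y \<in> insert TW ?C} \<subseteq> {TW}"
          using C False by auto
        then have "card {y\<in>insert TW (seg m p n). D x \<le> D y \<and> y \<in> insert TW ?C} \<le> 1"
          using card_mono[of "{TW}"] by fastforce
        ultimately show ?thesis using assms(1) by simp
      qed
    next
      have "n M - 1 \<noteq> p M + 1" "n M - 1 \<noteq> 1" "n M \<noteq> 1" "n M \<noteq> p M + 1" "n M \<noteq> p M + 2" using pM by linarith+
      then show "D (TI M (n M)) = 0" "D (TI M (n M - 1)) \<le> 1" unfolding D by simp_all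
      show "TI M (n M) \<in> insert TW (seg m p n)" "TI M (n M - 1) \<in> insert TW (seg m p n)"
        "TI M (n M) \<noteq> TI M (n M - 1)" using pM assms(2) by auto
      show "card (insert TW (seg m p n)) \<le> k" using p(3) k_pos by simp
    qed (use x in auto)
  qed (use p1 p(3) False in auto)
qed

text \<open>In the last block the two vertices \<open>p\<close> and \<open>q\<close> next to \<open>TW\<close> on leg \<open>M\<close> are coloured last. Each has a
  single neighbour \<open>z\<close> resp. \<open>y\<close> outside the block, hence exactly one available colour in the worst case;
  the colour that \<open>y\<close> has to avoid makes the two remaining lists different.\<close>

lemma tight_colourable:
  assumes k: "k = m + 2" and M: "M < m" "0 < M" "n 0 \<le> n M" "n M \<noteq> 6" "n M \<noteq> 4"
    and n3: "\<And>i. i < m \<Longrightarrow> 0 < i \<Longrightarrow> 3 \<le> n i"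
    and long: "5 \<le> n M \<or> m = 2"
  shows colourable
proof -
  \<comment> \<open>Leg 0 stays whole, leg \<open>M\<close> loses three positions and every other
    leg one; with \<open>TW\<close> this makes \<open>3 + (m - 2) + 1 = k\<close> vertices.\<close>
  define r where "r i = (if i = 0 then n 0 else if i = M then n M - 3 else n i - 1)" for i
  have rM: "r M = n M - 3" and r0: "r 0 = n 0" using M by (auto simp: r_def)
  have nM: "3 \<le> n M" using n3 M by blast
  have r_le: "\<forall>i<m. r i \<le> n i" by (auto simp: r_def)
  have r_less: "r i < n i" if "i < m" "0 < i" for i using n3[OF that] that by (auto simp: r_def)
  have sub: "spider m r \<subseteq> spider m n" "seg m r n \<subseteq> spider m n" using spider_split[OF r_le] by auto
  let ?p = "TI M (n M)" and ?q = "TI M (n M - 1)" and ?z = "TI 0 (n 0)"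
  \<comment> \<open>For \<open>n M = 3\<close> leg \<open>M\<close> disappears entirely, and the
    outside neighbour of \<open>?q\<close>, at position 0, is \<open>TU\<close>.\<close>
  let ?y = "if n M = 3 then TU else TI M (n M - 3)"
  have "spiderlike r"
    unfolding spiderlike_def
  proof (intro ballI impI)
    fix x y assume xy: "x \<in> spider m r" "y \<in> spider m r" "theta_adj m n x y"
    show "spider_adj x y"
    proof (rule adj_spider_adj[OF _ _ xy(3)])
      fix i i' assume "x = TI i (n i)" "y = TI i' (n i')"
      then have "i < m" "n i \<le> r i" "i' < m" "n i' \<le> r i'" using xy by simp_all
      then show "i = i'" using r_less[of i] r_less[of i'] by (cases "i = 0"; cases "i' = 0") auto
    qed (use xy sub in auto)
  qed
  have z: "?z \<in> spider m r" using M r0 n_pos[of 0] by simp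
  \<comment> \<open>If the lists of \<open>?p\<close> and \<open>?q\<close> are equal, they must
    lose different colours, so \<open>?y\<close> avoids the colour of \<open>?z\<close>. Otherwise
    \<open>?y\<close> avoids a colour \<open>c\<close> of \<open>L ?q\<close> that is missing from
    \<open>L ?p\<close>. Either way \<open>diff_lists_distinct\<close> becomes applicable.\<close>
  define b where "b \<longleftrightarrow> L ?p = L ?q"
  obtain c where c: "\<not> b \<Longrightarrow> c \<in> L ?q - L ?p"
  proof (cases b)
    case False
    then have "\<not> L ?q \<subseteq> L ?p" using card_subset_eq[OF finite_L, of "L ?q" ?p] card_L b_def by auto
    then show ?thesis using that by blast
  qed (use that in blast)
  have "\<exists>f. bounded_colouring (theta_adj m n) L ((card (spider m r) + k - 1) div k) (spider m r) f \<and>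
    f ?y \<noteq> (if b then f ?z else c)"
  \<comment> \<open>For \<open>n M \<ge> 5\<close> leg \<open>M\<close> keeps \<open>n M - 3\<close>
    positions, and \<open>n M \<noteq> 6\<close> rules out the length 3 barred in
    \<open>spider_avoiding\<close>. For \<open>n M = 3\<close> the spider fits into one
    block.\<close>
  proof (cases "n M = 3")
    case False
    then have 5: "5 \<le> n M" using nM M(5) by simp
    then show ?thesis
      using spider_avoiding[OF \<open>spiderlike r\<close> _ M(1) _ _ z, where b = b and c = c] M k rM by auto
  next
    case True
    then have m2: "m = 2" "M = 1" using long M by auto
    have "(\<Sum>i<m. r i) = r 0 + r M" using m2 by (simp add: numeral_2_eq_2)
    then have "card (spider m r) \<le> k" using True M(3) r0 rM k m2(1) by (simp add: card_spider)
    then have "\<exists>f. bounded_colouring (theta_adj m n) L 1 (spider m r) f \<and> f ?y \<noteq> (if b then f ?z else c)"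
      by (intro single_block_avoiding) (use True z k in auto)
    moreover have "1 \<le> (card (spider m r) + k - 1) div k"
      by (rule blocks_pos) (use k_pos card_spider in auto)
    ultimately show ?thesis using bounded_colouring_mono by metis
  qed
  then obtain f where f: "bounded_colouring (theta_adj m n) L ((card (spider m r) + k - 1) div k) (spider m r) f"
    "f ?y \<noteq> (if b then f ?z else c)" by blast
  let ?S = "insert TW (seg m r n)"
  let ?S' = "?S - {?p, ?q}"
  have pq: "?p \<in> ?S" "?q \<in> ?S" "?p \<noteq> ?q" using M nM rM by auto
  have cS: "card ?S = k"
  proof -
    have "(\<Sum>i<m. n i - r i) = (\<Sum>i\<in>{..<m} - {0, M}. n i - r i) + (\<Sum>i\<in>{0, M}. n i - r i)"
      by (rule sum.subset_diff) (use M in auto)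
    also have "(\<Sum>i\<in>{0, M}. n i - r i) = 3" using M r0 rM nM by simp
    also have "(\<Sum>i\<in>{..<m} - {0, M}. n i - r i) = (\<Sum>i\<in>{..<m} - {0, M}. 1)"
      by (rule sum.cong) (use n_pos in \<open>auto simp: r_def\<close>)
    also have "\<dots> = m - 2" using M by (simp add: card_Diff_subset)
    finally show ?thesis using M k by (simp add: card_seg)
  qed
  have cS': "card ?S' = k - 2" using card_Diff_subset[of "{?p, ?q}" ?S] pq cS by simp
  \<comment> \<open>\<open>TW\<close> sees up to two vertices for leg 0, one of which may be
    \<open>TU\<close>, and one on each of the \<open>m - 2\<close> legs other than 0 and
    \<open>M\<close>. Last positions in the block additionally see the uncut tip
    \<open>?z\<close>.\<close>
  let ?D = "\<lambda>x. if x = TW then m else legdeg m r x + (if \<exists>i. x = TI i (n i) then 1 else 0)"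
  have deg: "card {y\<in>spider m r. theta_adj m n x y} \<le> ?D x" if x: "x \<in> ?S" for x
  proof (cases "x = TW")
    case True
    let ?Z = "insert (if n 0 = 1 then TU else TI 0 (n 0 - 1)) (insert ?z ((\<lambda>i. TI i (n i - 1)) ` ({..<m} - {0, M})))"
    have "{y\<in>spider m r. theta_adj m n TW y} \<subseteq> ?Z"
    proof
      fix y assume y: "y \<in> {y\<in>spider m r. theta_adj m n TW y}"
      show "y \<in> ?Z"
      proof (cases y)
        case TU
        then obtain i where "i < m" "n i = 1" using y by auto
        then have "n 0 = 1" using n3[of i] by (cases "i = 0") auto
        then show ?thesis using TU by simp
      next
        case (TI i j)
        then have ij: "i < m" "j \<le> r i" "n i \<le> j + 1" "0 < j" using y by auto
        show ?thesis
        proof (cases "i = 0")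
          case True
          then have "j = n 0 \<or> j = n 0 - 1 \<and> n 0 \<noteq> 1" using ij r0 by auto
          then show ?thesis using True TI by auto
        next
          case False
          then have "j = n i - 1" using r_less[of i] ij by simp
          moreover have "i \<noteq> M" using ij rM nM by auto
          ultimately show ?thesis using TI False ij by auto
        qed
      qed (use y in auto)
    qed
    then have "card {y\<in>spider m r. theta_adj m n TW y} \<le> card ?Z" by (intro card_mono) auto
    also have "\<dots> \<le> Suc (Suc (card ((\<lambda>i. TI i (n i - 1)) ` ({..<m} - {0, M}))))"
      by (simp add: card_insert_if)
    also have "card ((\<lambda>i. TI i (n i - 1)) ` ({..<m} - {0, M})) \<le> card ({..<m} - {0, M})"
      by (rule card_image_le) simp
    also have "card ({..<m} - {0, M}) = m - 2" using M by (simp add: card_Diff_subset)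
    finally show ?thesis using True M by simp
  next
    case False
    then have xs: "x \<in> seg m r n" using x by simp
    let ?e = "if \<exists>i. x = TI i (n i) then {?z} else {}"
    have "{y\<in>spider m r. theta_adj m n x y} \<subseteq> {y\<in>spider m r. spider_adj x y} \<union> ?e"
    proof
      fix y assume y: "y \<in> {y\<in>spider m r. theta_adj m n x y}"
      show "y \<in> {y\<in>spider m r. spider_adj x y} \<union> ?e"
      proof (cases "\<exists>i i'. x = TI i (n i) \<and> y = TI i' (n i')")
        case True
        then obtain i i' where i: "x = TI i (n i)" "y = TI i' (n i')" by blast
        then have "i' = 0" using y r_less[of i'] by (cases "i' = 0") auto
        then show ?thesis using i by auto
      next
        case False
        then have "spider_adj x y" using adj_spider_adj[of x y] y xs sub by blast
        then show ?thesis using y by simp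
      qed
    qed
    then have "card {y\<in>spider m r. theta_adj m n x y} \<le> card ({y\<in>spider m r. spider_adj x y} \<union> ?e)"
      by (intro card_mono) auto
    also have "\<dots> \<le> card {y\<in>spider m r. spider_adj x y} + card ?e" by (rule card_Un_le)
    also have "\<dots> \<le> legdeg m r x + card ?e" using legdeg[OF xs] by simp
    also have "card ?e = (if \<exists>i. x = TI i (n i) then 1 else 0)" by simp
    finally show ?thesis using False by presburger
  qed
  let ?x = "TI M (n M - 2)"
  \<comment> \<open>For \<open>n M = 3\<close> this vertex is a first position, and
    \<open>m = 2\<close> keeps its count at 2.\<close>
  have Dx: "?D ?x \<le> 2"
  proof (cases "n M = 3")
    case True
    then have m2: "m = 2" "M = 1" using long M by auto
    have "{i. i < m \<and> 1 \<le> r i} \<subseteq> {0}" using m2 rM True by (auto simp: less_2_cases_iff)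
    then have "card {i. i < m \<and> 1 \<le> r i} \<le> card {0::nat}" by (intro card_mono) auto
    then show ?thesis using True by simp
  next
    case False
    then show ?thesis using nM by auto
  qed
  have D3: "?D x \<le> 3" if "x \<in> ?S'" "x \<noteq> TW" for x
  proof (cases x)
    case (TI i j)
    show ?thesis
    proof (cases "i = M")
      case True
      then have "x = ?x" using TI that rM nM by auto
      then show ?thesis using Dx by simp
    next
      case False
      then have "i < m" "i \<noteq> 0" "r i = n i - 1" "r i < j" "j \<le> n i" using TI that r0 by (auto simp: r_def split: if_splits)
      then have "j = n i" "r i + 1 = n i" using n_pos[of i] by auto
      moreover have "3 \<le> n i" using n3 \<open>i < m\<close> \<open>i \<noteq> 0\<close> by simp
      ultimately show ?thesis using TI by auto
    qed
  qed (use that in auto)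
  have "\<exists>g. inj_on g ?S' \<and> (\<forall>x\<in>?S'. g x \<in> L x \<and> g x \<notin> {} \<and> (\<forall>y\<in>spider m r. theta_adj m n x y \<longrightarrow> g x \<noteq> f y))"
  proof (rule block_choice[where D = ?D])
    fix x assume x: "x \<in> ?S'"
    show "card {y\<in>spider m r. theta_adj m n x y} + card {} \<le> ?D x" using deg[of x] x by simp
    have xin: "?x \<in> ?S'" using M nM rM by auto
    \<comment> \<open>Without \<open>?p\<close> and \<open>?q\<close> the block has
      \<open>k - 2\<close> vertices, so counts up to 2 are harmless. For count 3 the vertex
      \<open>?x\<close> drops out, and a larger count belongs to \<open>TW\<close> alone.\<close>
    consider "?D x \<le> 2" | "?D x = 3" | "x = TW" "4 \<le> m" using D3[OF x] by fastforce
    then show "card {y\<in>?S'. ?D x \<le> ?D y} + ?D x \<le> k"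
    proof cases
      case 1
      have "card {y\<in>?S'. ?D x \<le> ?D y} \<le> card ?S'" by (rule card_mono) auto
      then show ?thesis using 1 cS' k by linarith
    next
      case 2
      have "card {y\<in>?S'. ?D x \<le> ?D y} \<le> card (?S' - {?x})"
        by (rule card_mono) (use 2 Dx in auto)
      also have "\<dots> = k - 3" using cS' xin by (subst card_Diff_singleton) auto
      finally show ?thesis using 2 k M by linarith
    next
      case 3
      have "{y\<in>?S'. ?D x \<le> ?D y} \<subseteq> {TW}"
      proof
        fix y assume y: "y \<in> {y\<in>?S'. ?D x \<le> ?D y}"
        have "?D x = m" using 3 by simp
        then have "4 \<le> ?D y" using 3 y by simp
        then show "y \<in> {TW}" using D3[of y] y by fastforce
      qed
      then have "card {y\<in>?S'. ?D x \<le> ?D y} \<le> card {TW}" by (intro card_mono) auto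
      then show ?thesis using 3 k by simp
    qed
  qed auto
  then obtain g where g: "inj_on g ?S'" "\<And>x. x \<in> ?S' \<Longrightarrow> g x \<in> L x"
    "\<And>x y. x \<in> ?S' \<Longrightarrow> y \<in> spider m r \<Longrightarrow> theta_adj m n x y \<Longrightarrow> g x \<noteq> f y" by blast
  let ?P = "L ?p - {f ?z}" and ?Q = "L ?q - {f ?y}"
  have cards: "k - 2 < card ?P" "k - 2 < card ?Q"
    using diff_card_le_card_Diff[of "{f ?z}" "L ?p"] diff_card_le_card_Diff[of "{f ?y}" "L ?q"] k
    by (simp_all add: card_L)
  have "\<exists>c d. c \<in> ?P - g ` ?S' \<and> d \<in> ?Q - g ` ?S' \<and> c \<noteq> d"
  proof (rule distinct_pair[OF _ _ _ _ cards])
    show "card (g ` ?S') \<le> k - 2" using card_image_le[of ?S' g] cS' by simp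
    assume eq: "?P = ?Q"
    \<comment> \<open>Equal reduced lists have lost no colour, so all \<open>k\<close> colours are
      left.\<close>
    have "k - 1 < card ?P"
    proof (rule diff_lists_distinct[OF _ _ _ _ eq, where z = c])
      show "L ?p = L ?q \<Longrightarrow> f ?z \<noteq> f ?y" using f(2) b_def by simp
      show "L ?p \<noteq> L ?q \<Longrightarrow> c \<in> L ?q - L ?p \<and> f ?y \<noteq> c" using f(2) b_def c by simp
    qed (use k card_L in auto)
    then show "Suc (k - 2) < card ?P" using k by simp
  qed (use finite_L in auto)
  then obtain c' d' where cd: "c' \<in> ?P" "c' \<notin> g ` ?S'" "d' \<in> ?Q" "d' \<notin> g ` ?S'" "c' \<noteq> d'" by blast
  obtain h where hp: "h ?p = c'" "h ?q = d'" "\<And>x. x \<in> ?S' \<Longrightarrow> h x = g x"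
    by (rule that[of "g(?p := c', ?q := d')"]) (use pq(3) in auto)
  have "bounded_colouring (theta_adj m n) L (Suc ((card (spider m r) + k - 1) div k)) (spider m r \<union> ?S)
    (\<lambda>x. if x \<in> ?S then h x else f x)"
  proof (rule extend_by[OF f(1)])
    have S: "?S = insert ?p (insert ?q ?S')" using pq by blast
    have "inj_on h ?S'" using g(1) inj_on_cong[of ?S' h g] hp(3) by blast
    moreover have "h ` ?S' = g ` ?S'" using hp(3) by (rule image_cong[OF refl])
    moreover have "?S - {?p} - {?q} = ?S'" by blast
    moreover have "insert ?q ?S' - {?p} = insert ?q ?S'" "?S' - {?q} = ?S'" using pq by blast+
    ultimately have "inj_on h (insert ?p (insert ?q ?S'))"
      using cd(2,4,5) hp(1,2) unfolding inj_on_insert image_insert by auto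
    then show "inj_on h ?S" unfolding S[symmetric] .
    show "h x \<in> L x" if "x \<in> ?S" for x
    proof -
      consider "x = ?p" | "x = ?q" | "x \<in> ?S'" using \<open>x \<in> ?S\<close> by blast
      then show ?thesis
      proof cases
        case 1
        then show ?thesis using cd(1) hp(1) by auto
      next
        case 2
        then show ?thesis using cd(3) hp(2) by auto
      next
        case 3
        then show ?thesis using g(2) hp(3) by metis
      qed
    qed
    fix x y assume x: "x \<in> ?S" and y: "y \<in> spider m r" and a: "theta_adj m n x y"
    consider "x = ?p" | "x = ?q" | "x \<in> ?S'" using x by blast
    then show "h x \<noteq> f y"
    proof cases
      case 1
      have "y = ?z"
      proof (cases y)
        case TU
        then show ?thesis using a 1 nM by simp
      next
        case TW
        then show ?thesis using y by simp
      next
        case (TI i j)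
        have "i \<noteq> M"
        proof
          assume "i = M"
          then have "j \<le> n M - 3" "n M \<le> j + 2" using a y TI 1 rM by auto
          then show False using nM by simp
        qed
        then have "j = n i" using a TI 1 nM by auto
        then have "i = 0" using y TI r_less[of i] by (cases "i = 0") auto
        then show ?thesis using TI \<open>j = n i\<close> by simp
      qed
      then show ?thesis using 1 cd(1) hp(1) by auto
    next
      case 2
      have "y = ?y"
      proof (cases y)
        case TU
        then show ?thesis using a 2 nM by simp
      next
        case TW
        then show ?thesis using y by simp
      next
        case (TI i j)
        have "i = M" using a TI 2 nM by auto
        then have "j \<le> n M - 3" "n M - 1 \<le> j + 2" "0 < j" using a y TI 2 rM by auto
        then have "j = n M - 3" "n M \<noteq> 3" by auto
        then show ?thesis using TI \<open>i = M\<close> by simp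
      qed
      then show ?thesis using 2 cd(3) hp(2) by auto
    next
      case 3
      then show ?thesis using g(3) y a hp(3) by metis
    qed
  qed (use spider_disjoint in auto)
  moreover have "spider m r \<union> ?S = verts" using spider_split[OF r_le] by (auto simp: verts_def)
  moreover have "card verts = card (spider m r) + k"
  proof -
    have "card (spider m r \<union> ?S) = card (spider m r) + card ?S"
      by (rule card_Un_disjoint) (use spider_disjoint in auto)
    then show ?thesis unfolding calculation(2) cS .
  qed
  ultimately show ?thesis unfolding colourable_def using blocks_step[OF k_pos] by metis
qed

end

section \<open>Paths of length at most two\<close>

lemma ex_mem_not_in_list: "length xs < card A \<Longrightarrow> \<exists>c\<in>A. c \<notin> set xs"
  by (metis card_length card_mono finite_set leD le_trans subsetI)

lemma card_fibre_le_1: "distinct (map f xs) \<Longrightarrow> card {v \<in> set xs. f v = c} \<le> 1"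
  by (auto simp: card_le_Suc0_iff_eq distinct_map inj_on_def)

context theta_lists
begin

lemma verts_simps [simp]: "TU \<in> verts" "TW \<in> verts" "TI i j \<in> verts \<longleftrightarrow> i < m \<and> 0 < j \<and> j \<le> n i"
  by (auto simp: verts_def)

lemma sum_n:
  assumes "0 < m" "\<And>i. 0 < i \<Longrightarrow> i < m \<Longrightarrow> n i = 3"
  shows "(\<Sum>i<m. n i) = n 0 + 3 * (m - 1)"
proof -
  have "{..<m} = insert 0 {0<..<m}" using assms(1) by auto
  then have "(\<Sum>i<m. n i) = n 0 + (\<Sum>i\<in>{0<..<m}. n i)" by simp
  also have "(\<Sum>i\<in>{0<..<m}. n i) = (\<Sum>i\<in>{0<..<m}. 3)" by (rule sum.cong) (use assms in auto)
  finally show ?thesis by simp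
qed

text \<open>The blocks are coloured in the order \<open>?T\<close>, \<open>?S2\<close>,
  \<open>?S1\<close>. The first one surrounds \<open>TU\<close>. The second contains
  \<open>TW\<close>, all of leg 1, which provides the low counts, and the last positions of the legs
  before \<open>m - 1\<close>. The third has only \<open>m - 1\<close> vertices and therefore
  tolerates larger counts.\<close>

lemma three_blocks_colourable:
  assumes k: "k = m + 2" and m: "3 \<le> m" and n3: "\<And>i. 0 < i \<Longrightarrow> i < m \<Longrightarrow> n i = 3"
    and n0: "n 0 = 3 \<or> n 0 = 1 \<and> 5 \<le> m"
  shows colourable
proof -
  let ?S1 = "insert (TI (m - 1) 3) ((\<lambda>i. TI i 2) ` {2..<m})"
  let ?S2 = "{TW, TI 1 2, TI 1 1} \<union> (\<lambda>i. TI i (n i)) ` {..<m - 1}"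
  let ?T = "verts - (?S1 \<union> ?S2)"
  have n1: "n 1 = 3" and nm: "n (m - 1) = 3" using n3 m by auto
  have "TI i (n i) \<in> verts" if "i < m - 1" for i
  proof -
    have "i < m" using that by simp
    then show ?thesis using n_pos[of i] by simp
  qed
  then have sub: "?S1 \<union> ?S2 \<subseteq> verts" using m n3 by auto
  have disj: "?S1 \<inter> ?S2 = {}" using n3 n0 by auto
  have c1: "card ?S1 = m - 1"
    using m by (subst card_insert_disjoint) (auto simp: card_image inj_on_def)
  have "card ?S2 = card {TW, TI 1 2, TI 1 1} + card ((\<lambda>i. TI i (n i)) ` {..<m - 1})"
    by (rule card_Un_disjoint) (use n1 in auto)
  then have c2: "card ?S2 = k" using m k by (simp add: card_image inj_on_def)
  have cV: "card verts = n 0 + 3 * m - 1" using sum_n[OF _ n3] m by (simp add: card_verts)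
  have "card ?T = card verts - card (?S1 \<union> ?S2)" using sub by (intro card_Diff_subset) auto
  also have "card (?S1 \<union> ?S2) = (m - 1) + k" using disj c1 c2 by (subst card_Un_disjoint) auto
  finally have cT: "card ?T \<le> k" using cV n0 k m by auto
  obtain f where f: "bounded_colouring (theta_adj m n) L 1 ?T f"
    using single_block[of ?T] cT by auto
  \<comment> \<open>\<open>TI 1 1\<close> and, for \<open>n 0 = 1\<close>, \<open>TI 0 1\<close> see
    \<open>TU\<close> and at most \<open>m - 1\<close> other first positions. These at most two
    vertices of count \<open>m\<close> fit because \<open>k = m + 2\<close>.\<close>
  let ?D2 = "\<lambda>x. if x = TI 1 3 then 0 else if x = TI 1 2 then 1
    else if x \<in> {TI 1 1, TI 0 1} then m else 2 :: nat"
  have "\<exists>g. bounded_colouring (theta_adj m n) L (Suc 1) (?T \<union> ?S2) g"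
  proof (rule extend_block[OF f, where D = ?D2])
    fix x assume x: "x \<in> ?S2"
    show "card {y\<in>?T. theta_adj m n x y} \<le> ?D2 x"
    proof -
      have bound: "card {y\<in>?T. theta_adj m n x y} \<le> card Z" if "finite Z" "\<And>y. y \<in> ?T \<Longrightarrow> theta_adj m n x y \<Longrightarrow> y \<in> Z" for Z
        by (rule card_mono) (use that in auto)
      have cC: "card (insert TU ((\<lambda>i. TI i 1) ` ({..<m} - {l}))) \<le> m" if "l < m" for l
      proof -
        have "card ((\<lambda>i. TI i 1) ` ({..<m} - {l})) \<le> card ({..<m} - {l})" by (rule card_image_le) simp
        then have "card ((\<lambda>i. TI i 1) ` ({..<m} - {l})) < m" using that by simp
        then show ?thesis by (simp add: card_insert_if del: One_nat_def)
      qed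
      have T1: "i \<noteq> 1" "i = m - 1 \<or> j \<noteq> n i" "i \<ge> 2 \<Longrightarrow> j = 1" if "TI i j \<in> ?T" for i j
      proof -
        have ij: "i < m" "0 < j" "j \<le> n i" using that by auto
        have "i = 1 \<Longrightarrow> j = 1 \<or> j = 2 \<or> j = 3" using ij n1 by auto
        then show "i \<noteq> 1" using that n1 m by (auto simp: image_iff)
        show "i = m - 1 \<or> j \<noteq> n i" using that ij by (cases "i = m - 1") (auto simp: image_iff)
        assume "i \<ge> 2"
        then have "n i = 3" using n3 ij by auto
        moreover have "j \<noteq> 2" using that ij \<open>i \<ge> 2\<close> by auto
        moreover have "j \<noteq> 3" using that ij \<open>n i = 3\<close> by (cases "i = m - 1") (auto simp: image_iff)
        ultimately show "j = 1" using ij by linarith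
      qed
      consider "x = TI 1 3" | "x = TI 1 2" | l where "l < 2" "x = TI l 1" | "x = TW"
        | i where "x = TI i 3" "i \<noteq> 1" "i < m - 1" "n i = 3"
      proof (cases "x \<in> {TW, TI 1 2, TI 1 1}")
        case True
        then show ?thesis using that(2,4) that(3)[of 1] by auto
      next
        case False
        then obtain i where i: "i < m - 1" "x = TI i (n i)" using x by blast
        consider "i = 1" | "n i = 3" "i \<noteq> 1" | "i = 0" "n 0 = 1" using n3[of i] n0 i(1) by force
        then show ?thesis
        proof cases
          case 1 then show ?thesis using that(1) i n1 by simp
        next
          case 2 then show ?thesis using that(5)[of i] i by simp
        next
          case 3 then show ?thesis using that(3)[of 0] i by simp
        qed
      qed
      then show ?thesis
      proof cases
        case 1
        have "y \<in> {}" if y: "y \<in> ?T" "theta_adj m n x y" for y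
        proof (cases y)
          case (TI i j)
          then show ?thesis using T1[of i j] y 1 n1 nm by (cases "i = m - 1") (use m in auto)
        qed (use y 1 in auto)
        then have "card {y\<in>?T. theta_adj m n x y} \<le> card ({} :: theta_vertex set)"
          by (rule bound[OF finite.emptyI])
        then show ?thesis unfolding card.empty by (rule order_trans) simp
      next
        case 2
        have "y \<in> {TU}" if y: "y \<in> ?T" "theta_adj m n x y" for y
        proof (cases y)
          case (TI i j)
          then show ?thesis using T1[of i j] y 2 n1 by auto
        qed (use y 2 in auto)
        then show ?thesis using bound[of "{TU}"] 2 by simp
      next
        case (3 l)
        have "y \<in> insert TU ((\<lambda>i. TI i 1) ` ({..<m} - {l}))" if y: "y \<in> ?T" "theta_adj m n x y" for y
        proof (cases y)
          case (TI i j)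
          have ij: "i < m" "i \<noteq> 1" "i \<ge> 2 \<Longrightarrow> j = 1" "i = m - 1 \<or> j \<noteq> n i" "0 < j" "j \<le> n i" using T1[of i j] y TI by auto
          show ?thesis
          proof (cases "i = l")
            case True
            then have "i = 0" "l = 0" using 3 ij by auto
            then have "n 0 = 3" using n0 ij True m by auto
            then have "x \<notin> ?S2" using 3 \<open>l = 0\<close> m by auto
            then show ?thesis using x by blast
          next
            case False
            then have "j = 1" using y 3 ij TI n1 n0 by (cases "i \<ge> 2") auto
            then show ?thesis using False ij TI by auto
          qed
        qed (use y 3 in auto)
        from bound[OF _ this] cC[of l] 3 m have "card {y\<in>?T. theta_adj m n x y} \<le> m" by fastforce
        then show ?thesis using 3 by (auto simp: less_2_cases_iff)
      next
        case 4
        have "y \<in> {TU, TI 0 2}" if y: "y \<in> ?T" "theta_adj m n x y" for y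
        proof (cases y)
          case (TI i j)
          have ij: "i < m" "i \<noteq> 1" "i \<ge> 2 \<Longrightarrow> j = 1" "i = m - 1 \<or> j \<noteq> n i" "0 < j" "j \<le> n i" using T1[of i j] y TI by auto
          moreover have "n i \<le> j + 1" using y TI 4 by simp
          ultimately have "i < 2" using n3[of i] by (cases "i < 2") auto
          then have "i = 0" using ij by simp
          then have "j = 2" using ij \<open>n i \<le> j + 1\<close> n0 m by auto
          then show ?thesis using TI \<open>i = 0\<close> by simp
        qed (use y 4 in auto)
        then show ?thesis using bound[of "{TU, TI 0 2}"] card_le_2[of TU "TI 0 2"] 4 by simp
      next
        case (5 i)
        have "y \<in> {TI i 1, TI i 2}" if y: "y \<in> ?T" "theta_adj m n x y" for y
        proof (cases y)
          case (TI i' j)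
          have ij: "i' < m" "i' = m - 1 \<or> j \<noteq> n i'" "0 < j" "j \<le> n i'" "i' \<ge> 2 \<Longrightarrow> j = 1"
            using T1[of i' j] y TI by auto
          have "i' = i"
          proof (rule ccontr)
            assume "i' \<noteq> i"
            then have "j = n i'" using y 5 TI by auto
            then have "i' = m - 1" "j = 3" using ij nm by auto
            then show False using ij m by simp
          qed
          then have "j \<noteq> 3" using ij 5 by auto
          then show ?thesis using ij 5 TI \<open>i' = i\<close> by auto
        qed (use y 5 in auto)
        then have "card {y\<in>?T. theta_adj m n x y} \<le> 2"
          using bound[of "{TI i 1, TI i 2}"] card_le_2[of "TI i 1" "TI i 2"] by fastforce
        then show ?thesis using 5 by simp
      qed
    qed
    show "card {y\<in>?S2. ?D2 x \<le> ?D2 y} + ?D2 x \<le> k"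
    proof (rule rank_condition[where p = "TI 1 3" and q = "TI 1 2" and U = "{TI 1 1, TI 0 1}"])
      fix x assume "x \<in> ?S2" "3 \<le> ?D2 x"
      then have "?D2 x = m" by (auto split: if_splits)
      moreover have "card {y\<in>?S2. ?D2 x \<le> ?D2 y \<and> y \<in> {TI 1 1, TI 0 1}} \<le> card {TI 1 1, TI 0 1}"
        by (rule card_mono) auto
      ultimately show "card {y\<in>?S2. ?D2 x \<le> ?D2 y \<and> y \<in> {TI 1 1, TI 0 1}} + ?D2 x \<le> k"
        using k card_le_2[of "TI 1 1" "TI 0 1"] by linarith
    next
      show "TI 1 3 \<in> ?S2" using n1 m by (auto simp: image_iff)
    qed (use x c2 in auto)
  qed auto
  then obtain g where g: "bounded_colouring (theta_adj m n) L (Suc 1) (?T \<union> ?S2) g" ..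
  let ?c = "TI (m - 1) 2"
  \<comment> \<open>A middle position has four neighbours in all; on leg \<open>m - 1\<close> one of
    them lies in \<open>?S1\<close>. The greedy sums are at most \<open>(m - 1) + 3\<close>,
    \<open>(m - 2) + 4\<close> and \<open>1 + (m + 1)\<close>, each equal to
    \<open>k\<close>.\<close>
  let ?D1 = "\<lambda>x. if x = TI (m - 1) 3 then m + 1 else if x = ?c then 3 else 4 :: nat"
  have "\<exists>h. bounded_colouring (theta_adj m n) L (Suc (Suc 1)) ((?T \<union> ?S2) \<union> ?S1) h"
  proof (rule extend_block[OF g, where D = ?D1])
    fix x assume x: "x \<in> ?S1"
    show "card {y\<in>?T \<union> ?S2. theta_adj m n x y} \<le> ?D1 x"
    proof -
      have bound: "card {y\<in>?T \<union> ?S2. theta_adj m n x y} \<le> card Z"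
        if "finite Z" "\<And>y. y \<in> verts \<Longrightarrow> y \<notin> ?S1 \<Longrightarrow> theta_adj m n x y \<Longrightarrow> y \<in> Z" for Z
      proof (rule card_mono[OF that(1)], rule subsetI)
        fix y assume y: "y \<in> {y\<in>?T \<union> ?S2. theta_adj m n x y}"
        then have "y \<in> verts" using sub by blast
        moreover have "y \<notin> ?S1" using y disj by blast
        ultimately show "y \<in> Z" using that(2) y by blast
      qed
      consider "x = TI (m - 1) 3" | i where "x = TI i 2" "2 \<le> i" "i < m" using x by auto
      then show ?thesis
      proof cases
        case 1
        let ?Z = "{TW, TI (m - 1) 1} \<union> (\<lambda>i. TI i (n i)) ` {..<m - 1}"
        have "y \<in> ?Z" if y: "y \<in> verts" "y \<notin> ?S1" "theta_adj m n x y" for y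
        proof (cases y)
          case (TI i j)
          show ?thesis
          proof (cases "i = m - 1")
            case True
            then have "j = 1 \<or> j = 2 \<or> j = 3" using y TI nm by auto
            then have "j = 1" using y True TI m by auto
            then show ?thesis using TI True by simp
          next
            case False
            then have "j = n i" "i < m - 1" using y TI 1 by auto
            then show ?thesis using TI by auto
          qed
        qed (use y 1 in auto)
        from bound[OF _ this] have "card {y\<in>?T \<union> ?S2. theta_adj m n x y} \<le> card ?Z" by auto
        also have "\<dots> \<le> card {TW, TI (m - 1) 1} + card ((\<lambda>i. TI i (n i)) ` {..<m - 1})" by (rule card_Un_le)
        also have "\<dots> \<le> 2 + (m - 1)"
          using card_le_2[of TW "TI (m - 1) 1"] card_image_le[of "{..<m - 1}" "\<lambda>i. TI i (n i)"] by simp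
        finally show ?thesis using 1 m by simp
      next
        case (2 i)
        have ni: "n i = 3" using n3 2 by simp
        have Z: "y \<in> {TU, TW, TI i 1, TI i 3}" if y: "y \<in> verts" "theta_adj m n x y" for y
        proof (cases y)
          case (TI i' j)
          then have "i' = i" "j \<noteq> 2" "0 < j" "j \<le> 3" using y 2 ni by auto
          then have "j = 1 \<or> j = 3" by linarith
          then show ?thesis using TI \<open>i' = i\<close> by auto
        qed (use y in auto)
        show ?thesis
        proof (cases "i = m - 1")
          case True
          have "card {y\<in>?T \<union> ?S2. theta_adj m n x y} \<le> card {TU, TW, TI i 1}"
            by (rule bound) (use Z True in auto)
          then show ?thesis using 2 True by simp
        next
          case False
          have "card {y\<in>?T \<union> ?S2. theta_adj m n x y} \<le> card {TU, TW, TI i 1, TI i 3}"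
            by (rule bound) (use Z in auto)
          then show ?thesis using 2 False by simp
        qed
      qed
    qed
    have cin: "?c \<in> ?S1" using m by auto
    have no_c: "card {y\<in>?S1. 4 \<le> ?D1 y} \<le> m - 2"
    proof -
      have "card {y\<in>?S1. 4 \<le> ?D1 y} \<le> card (?S1 - {?c})" by (rule card_mono) auto
      also have "\<dots> = m - 2" using c1 cin by (subst card_Diff_singleton) auto
      finally show ?thesis .
    qed
    have "d = 3 \<or> d = 4 \<or> d = m + 1 \<and> 4 \<le> m" if "d = 3 \<or> d = 4 \<or> d = m + 1" for d
      using that m by linarith
    moreover have "?D1 x = 3 \<or> ?D1 x = 4 \<or> ?D1 x = m + 1" by argo
    ultimately consider "?D1 x = 3" | "?D1 x = 4" | "?D1 x = m + 1" "4 \<le> m" by blast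
    then show "card {y\<in>?S1. ?D1 x \<le> ?D1 y} + ?D1 x \<le> k"
    proof cases
      case 1
      have "card {y\<in>?S1. ?D1 x \<le> ?D1 y} \<le> card ?S1" by (rule card_mono) auto
      then show ?thesis unfolding 1 using c1 k m by linarith
    next
      case 2
      then show ?thesis unfolding 2 using no_c k m by linarith
    next
      case 3
      have "card {y\<in>?S1. m + 1 \<le> ?D1 y} \<le> card {TI (m - 1) 3}"
        by (rule card_mono) (use 3 in \<open>auto split: if_splits\<close>)
      then show ?thesis unfolding 3(1) using k by simp
    qed
  qed (use disj in auto)
  moreover have "(?T \<union> ?S2) \<union> ?S1 = verts" using sub by blast
  moreover have "Suc (Suc 1) \<le> (card verts + k - 1) div k"
  proof -
    \<comment> \<open>Three blocks are allowed since there are more than \<open>2 * k\<close>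
      vertices. For \<open>n 0 = 1\<close> this means \<open>3 * m > 2 * m + 4\<close>, hence the
      condition \<open>5 \<le> m\<close>.\<close>
    have "3 * k \<le> card verts + k - 1" using cV n0 k m by auto
    then show ?thesis using k_pos by (simp add: less_eq_div_iff_mult_less_eq)
  qed
  ultimately show ?thesis unfolding colourable_def using bounded_colouring_mono by metis
qed

section \<open>The exceptional graphs K_{1,1,2} and K_{1,1,3}\<close>

text \<open>The total graph of K_{1,1,2} has nine vertices and two blocks. The vertices of
  \<open>?S\<close>, leg 1 and \<open>TW\<close>, have at most 1, 2, 3 and 4 neighbours in
  \<open>?T\<close>, which is exactly what the greedy order admits for \<open>k = 5\<close>.\<close>

lemma five_lists_colourable:
  assumes "k = 5" "m = 3" "n 0 = 1" "n 1 = 3" "n 2 = 3"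
  shows colourable
proof -
  let ?S = "{TI 1 2, TI 1 3, TI 1 1, TW}"
  let ?T = "verts - ?S"
  have "1 < m" using assms(2) by simp
  then have sub: "?S \<subseteq> verts" using assms(4) by auto
  have "(\<Sum>i<m. n i) = 7" using assms by (simp add: numeral_3_eq_3 numeral_2_eq_2)
  then have cV: "card verts = 9" by (simp add: card_verts)
  have "card ?T = 5" using cV sub by (subst card_Diff_subset) auto
  then obtain f where f: "bounded_colouring (theta_adj m n) L 1 ?T f"
    using single_block[of ?T] assms(1) by auto
  let ?D = "\<lambda>x. if x = TI 1 2 then 1 else if x = TI 1 3 then 2 else if x = TI 1 1 then 3 else 4 :: nat"
  have "\<exists>g. bounded_colouring (theta_adj m n) L (Suc 1) (?T \<union> ?S) g"
  proof (rule extend_block[OF f, where D = ?D])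
    fix x assume x: "x \<in> ?S"
    have bound: "card {y\<in>?T. theta_adj m n x y} \<le> card Z" if "finite Z" "\<And>y. y \<in> ?T \<Longrightarrow> theta_adj m n x y \<Longrightarrow> y \<in> Z" for Z
      by (rule card_mono) (use that in auto)
    have T: "y = TU \<or> y = TI 0 1 \<or> y = TI 2 1 \<or> y = TI 2 2 \<or> y = TI 2 3" if "y \<in> ?T" for y
    proof (cases y)
      case (TI i j)
      then have ij: "i < m" "0 < j" "j \<le> n i" "y \<notin> ?S" using that by auto
      then have "i = 0 \<or> i = 1 \<or> i = 2" using assms(2) by linarith
      then have "i = 0 \<and> j = 1 \<or> i = 1 \<and> (j = 1 \<or> j = 2 \<or> j = 3) \<or> i = 2 \<and> (j = 1 \<or> j = 2 \<or> j = 3)"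
        using ij assms(3-5) by auto
      then show ?thesis using ij TI by auto
    qed (use that in auto)
    consider "x = TI 1 2" | "x = TI 1 3" | "x = TI 1 1" | "x = TW" using x by blast
    then show "card {y\<in>?T. theta_adj m n x y} \<le> ?D x"
    proof cases
      case 1
      have "card {y\<in>?T. theta_adj m n x y} \<le> card {TU}"
        by (rule bound) (use T 1 assms in fastforce)+
      then show ?thesis using 1 by simp
    next
      case 2
      have "card {y\<in>?T. theta_adj m n x y} \<le> card {TI 2 3, TI 0 1}"
        by (rule bound) (use T 2 assms in fastforce)+
      then show ?thesis using 2 by simp
    next
      case 3
      have "card {y\<in>?T. theta_adj m n x y} \<le> card {TU, TI 0 1, TI 2 1}"
        by (rule bound) (use T 3 assms in fastforce)+
      then show ?thesis using 3 by simp
    next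
      case 4
      have "card {y\<in>?T. theta_adj m n x y} \<le> card {TU, TI 0 1, TI 2 2, TI 2 3}"
        by (rule bound) (use T 4 assms in fastforce)+
      then show ?thesis using 4 by simp
    qed
    have "{y\<in>?S. 2 \<le> ?D y} \<subseteq> {TI 1 3, TI 1 1, TW}" "{y\<in>?S. 3 \<le> ?D y} \<subseteq> {TI 1 1, TW}" "{y\<in>?S. 4 \<le> ?D y} \<subseteq> {TW}"
      "{y\<in>?S. 1 \<le> ?D y} \<subseteq> ?S"
      by auto
    then have "card {y\<in>?S. 2 \<le> ?D y} \<le> card {TI 1 3, TI 1 1, TW}" "card {y\<in>?S. 3 \<le> ?D y} \<le> card {TI 1 1, TW}"
      "card {y\<in>?S. 4 \<le> ?D y} \<le> card {TW}" "card {y\<in>?S. 1 \<le> ?D y} \<le> card ?S"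
      by (intro card_mono; simp)+
    then have le: "card {y\<in>?S. 1 \<le> ?D y} \<le> 4" "card {y\<in>?S. 2 \<le> ?D y} \<le> 3" "card {y\<in>?S. 3 \<le> ?D y} \<le> 2"
      "card {y\<in>?S. 4 \<le> ?D y} \<le> 1" by simp_all
    consider "?D x = 1" | "?D x = 2" | "?D x = 3" | "?D x = 4" by argo
    then show "card {y\<in>?S. ?D x \<le> ?D y} + ?D x \<le> k"
    proof cases
      case 1 show ?thesis unfolding 1 using le(1) assms(1) by linarith
    next
      case 2 show ?thesis unfolding 2 using le(2) assms(1) by linarith
    next
      case 3 show ?thesis unfolding 3 using le(3) assms(1) by linarith
    next
      case 4 show ?thesis unfolding 4 using le(4) assms(1) by linarith
    qed
  qed auto
  moreover have "?T \<union> ?S = verts" using sub by blast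
  moreover have "(card verts + k - 1) div k = Suc 1" using cV assms(1) by simp
  ultimately show ?thesis unfolding colourable_def by metis
qed

text \<open>The total graph of K_{1,1,3} has twelve vertices, so a colour may occur twice. The five
  colours listed in \<open>d1\<close> are distinct, so are those in \<open>d2\<close>, and
  \<open>e\<close> is in neither list. The twelfth colour \<open>c3\<close> either repeats
  \<open>e\<close>, on a vertex not adjacent to the edge \<open>TI 0 1\<close>, or extends the
  second list; so no colour occurs three times. The premises \<open>ne\<close> cover the adjacencies
  between the two sides.\<close>

lemma colourable_by_colours:
  assumes k: "k = 6" and m: "m = 4" and n0: "n 0 = 1" and n3: "n 1 = 3" "n 2 = 3" "n 3 = 3"
    and p: "{p1, p2, p3} = {1, 2, 3}" "distinct [p1, p2, p3]"
    and L: "e \<in> L (TI 0 1)" "u \<in> L TU" "w \<in> L TW"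
    "a1 \<in> L (TI p1 1)" "a2 \<in> L (TI p2 1)" "a3 \<in> L (TI p3 1)"
    "c1 \<in> L (TI p1 2)" "c2 \<in> L (TI p2 2)" "c3 \<in> L (TI p3 2)"
    "b1 \<in> L (TI p1 3)" "b2 \<in> L (TI p2 3)" "b3 \<in> L (TI p3 3)"
    and d1: "distinct [u, a1, a2, a3, c1]" and d2: "distinct [w, b1, b2, b3, c2]"
    and e: "e \<notin> {u, a1, a2, a3, c1, w, b1, b2, b3, c2}" and c3: "c3 = e \<or> c3 \<notin> {w, b1, b2, b3, c2}"
    and ne: "u \<noteq> w" "a1 \<noteq> b1" "a2 \<noteq> b2" "a3 \<noteq> b3"
    "c1 \<notin> {w, b1}" "c2 \<notin> {u, a2}" "c3 \<notin> {u, a3}"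
  shows colourable
proof -
  define f where "f v = (case v of TU \<Rightarrow> u | TW \<Rightarrow> w | TI i j \<Rightarrow> if i = 0 then e
    else if i = p1 then (if j = 1 then a1 else if j = 2 then c1 else b1)
    else if i = p2 then (if j = 1 then a2 else if j = 2 then c2 else b2)
    else (if j = 1 then a3 else if j = 2 then c3 else b3))" for v
  have p0: "p1 \<noteq> 0" "p2 \<noteq> 0" "p3 \<noteq> 0" using p(1) by auto
  have pd: "p1 \<noteq> p2" "p1 \<noteq> p3" "p2 \<noteq> p3" using p(2) by auto
  have "p1 \<in> {1, 2, 3}" "p2 \<in> {1, 2, 3}" "p3 \<in> {1, 2, 3}" using p(1) by blast+
  then have np: "n p1 = 3" "n p2 = 3" "n p3 = 3" using n3 by auto
  have pm: "i < m \<longleftrightarrow> i = 0 \<or> i = p1 \<or> i = p2 \<or> i = p3" for i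
  proof -
    have "i < m \<longleftrightarrow> i = 0 \<or> i \<in> {1, 2, 3}" using m by auto
    then show ?thesis unfolding p(1)[symmetric] by auto
  qed
  have j3: "0 < j \<and> j \<le> 3 \<longleftrightarrow> j = 1 \<or> j = 2 \<or> j = 3" for j :: nat by auto
  have fv: "f TU = u" "f TW = w" "f (TI 0 j) = e"
    "f (TI p1 1) = a1" "f (TI p2 1) = a2" "f (TI p3 1) = a3"
    "f (TI p1 2) = c1" "f (TI p2 2) = c2" "f (TI p3 2) = c3"
    "f (TI p1 3) = b1" "f (TI p2 3) = b2" "f (TI p3 3) = b3" for j
    using p0 pd by (auto simp: f_def)
  let ?A = "[TU, TI p1 1, TI p2 1, TI p3 1, TI p1 2]"
  let ?B = "[TW, TI p1 3, TI p2 3, TI p3 3, TI p2 2]"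
  have V: "verts = set ?A \<union> set ?B \<union> {TI 0 1, TI p3 2}"
  proof -
    have "x \<in> verts \<longleftrightarrow> x \<in> set ?A \<union> set ?B \<union> {TI 0 1, TI p3 2}" for x
    proof (cases x)
      case (TI i j)
      have "0 < j \<and> j \<le> n 0 \<longleftrightarrow> j = 1" using n0 by auto
      then have "x \<in> verts \<longleftrightarrow> i = 0 \<and> j = 1 \<or> (i = p1 \<or> i = p2 \<or> i = p3) \<and> (j = 1 \<or> j = 2 \<or> j = 3)"
        unfolding TI verts_simps pm using np j3[of j] by auto
      then show ?thesis using TI by auto
    qed auto
    then show ?thesis by blast
  qed
  have fL: "f v \<in> L v" if "v \<in> verts" for v
    using that L fv unfolding V by auto
  have proper: "f x \<noteq> f y" if x: "x \<in> verts" and y: "y \<in> verts" and adj: "theta_adj m n x y" for x y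
  proof -
    have sides: "f x \<noteq> f y" if "x \<in> set ?A \<union> {TI 0 1}" "y \<in> set ?A \<union> {TI 0 1}" "x \<noteq> y" for x y
      using that d1 e fv by (auto simp del: One_nat_def)
    have sides': "f x \<noteq> f y" if "x \<in> set ?B \<union> {TI 0 1}" "y \<in> set ?B \<union> {TI 0 1}" "x \<noteq> y" for x y
      using that d2 e fv by (auto simp del: One_nat_def)
    have cross: "f x \<noteq> f y" if "x \<in> set ?A" "y \<in> set ?B" "theta_adj m n x y" for x y
      using that ne fv np pd by (auto simp del: One_nat_def)
    have last: "f x \<noteq> f y" if "x = TI p3 2" "y \<in> verts" "theta_adj m n x y" for x y
      using that ne(7) c3 e fv np pd p0 unfolding V by (auto simp del: One_nat_def)
    have "x \<noteq> y" using adj theta_adj_irrefl by blast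
    have adj': "theta_adj m n y x" using adj theta_adj_sym by blast
    consider "x = TI p3 2" | "y = TI p3 2" | "x \<in> set ?A" "y \<in> set ?B" | "y \<in> set ?A" "x \<in> set ?B"
      | "x \<in> set ?A \<union> {TI 0 1}" "y \<in> set ?A \<union> {TI 0 1}"
      | "x \<in> set ?B \<union> {TI 0 1}" "y \<in> set ?B \<union> {TI 0 1}"
      using x y unfolding V by blast
    then show ?thesis
    proof cases
      case 1 then show ?thesis using last y adj by blast
    next
      case 2 then show ?thesis using last[of y x] x adj' by metis
    next
      case 3 then show ?thesis using cross adj by blast
    next
      case 4 then show ?thesis using cross[of y x] adj' by metis
    next
      case 5 then show ?thesis using sides \<open>x \<noteq> y\<close> by blast
    next
      case 6 then show ?thesis using sides' \<open>x \<noteq> y\<close> by blast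
    qed
  qed
  have count: "card {v \<in> verts. f v = c} \<le> 2" for c
  proof -
    have dA: "distinct (map f ?A)" using d1 fv by simp
    have dB: "distinct (map f ?B)" using d2 fv by simp
    have dB': "distinct (map f (TI p3 2 # ?B))" if "c3 \<noteq> e" using d2 c3 that fv by auto
    have un: "card {v \<in> verts. f v = c} \<le> 2"
      if "{v \<in> verts. f v = c} \<subseteq> {v \<in> set X. f v = c} \<union> {v \<in> set Y. f v = c}"
        "distinct (map f X)" "distinct (map f Y)" for X Y
    proof -
      have "card {v \<in> verts. f v = c} \<le> card ({v \<in> set X. f v = c} \<union> {v \<in> set Y. f v = c})"
        using that(1) by (intro card_mono) auto
      also have "\<dots> \<le> card {v \<in> set X. f v = c} + card {v \<in> set Y. f v = c}" by (rule card_Un_le)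
      finally show ?thesis using card_fibre_le_1[OF that(2), of c] card_fibre_le_1[OF that(3), of c] by linarith
    qed
    consider "c = e" | "c \<noteq> e" "c3 = e" | "c \<noteq> e" "c3 \<noteq> e" by blast
    then show ?thesis
    proof cases
      case 1
      have "f v \<noteq> e" if "v \<in> set ?A \<union> set ?B" for v using that e fv by auto
      then have "{v \<in> verts. f v = c} \<subseteq> {v \<in> set [TI 0 1]. f v = c} \<union> {v \<in> set [TI p3 2]. f v = c}"
        unfolding V using 1 by auto
      then show ?thesis by (rule un) simp_all
    next
      case 2
      then have "{v \<in> verts. f v = c} \<subseteq> {v \<in> set ?A. f v = c} \<union> {v \<in> set ?B. f v = c}"
        unfolding V using fv by auto
      then show ?thesis by (rule un[OF _ dA dB])
    next
      case 3
      then have "{v \<in> verts. f v = c} \<subseteq> {v \<in> set ?A. f v = c} \<union> {v \<in> set (TI p3 2 # ?B). f v = c}"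
        unfolding V using fv by auto
      then show ?thesis by (rule un[OF _ dA dB'[OF 3(2)]])
    qed
  qed
  have "(\<Sum>i<m. n i) = 10" using m n0 n3 by (simp add: eval_nat_numeral)
  then have "(card verts + k - 1) div k = 2" using k by (simp add: card_verts)
  moreover have "bounded_colouring (theta_adj m n) L 2 verts f"
    unfolding bounded_colouring_def using fL proper count by blast
  ultimately show ?thesis unfolding colourable_def by auto
qed

text \<open>If the edge \<open>uw\<close> shares a colour with some vertex of degree two, both get it, and all other vertices keep
  lists of size five. Otherwise the lists of these vertices are not affected by the colour of the edge \<open>uw\<close>.\<close>

lemma six_lists_colourable:
  assumes k: "k = 6" and m: "m = 4" and n: "n 0 = 1" "n 1 = 3" "n 2 = 3" "n 3 = 3"
  shows colourable
proof -
  have c6: "card (L x) = 6" for x using card_L k by simp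
  \<comment> \<open>Lists of exactly five colours that leave out a colour \<open>eps\<close>
    reserved for the edge \<open>TI 0 1\<close>.\<close>
  have "\<exists>M. \<forall>x. M x \<subseteq> L x - {eps} \<and> card (M x) = 5" for eps
  proof (rule choice, rule allI)
    fix x
    have "5 \<le> card (L x - {eps})" using diff_card_le_card_Diff[of "{eps}" "L x"] c6[of x] by simp
    then show "\<exists>M. M \<subseteq> L x - {eps} \<and> card M = 5" by (meson obtain_subset_with_card_n)
  qed
  then obtain M where M: "\<And>eps x. M eps x \<subseteq> L x - {eps}" "\<And>eps x. card (M eps x) = 5" by metis
  then have fM: "finite (M eps x)" for eps x by (metis card.infinite zero_neq_numeral)
  show ?thesis
  proof (cases "\<exists>i\<in>{1, 2, 3}. L (TI 0 1) \<inter> L (TI i 2) \<noteq> {}")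
    case True
    then obtain p3 eps where p3: "p3 \<in> {1, 2, 3}" and eps: "eps \<in> L (TI 0 1)" "eps \<in> L (TI p3 2)" by blast
    obtain p1 p2 where p: "{p1, p2, p3} = {1, 2, 3}" "distinct [p1, p2, p3]"
    proof -
      consider "p3 = 1" | "p3 = 2" | "p3 = 3" using p3 by blast
      then show ?thesis
      proof cases
        case 1 show ?thesis by (rule that[of 2 3]) (use 1 in auto)
      next
        case 2 show ?thesis by (rule that[of 1 3]) (use 2 in auto)
      next
        case 3 show ?thesis by (rule that[of 1 2]) (use 3 in auto)
      qed
    qed
    let ?M = "M eps"
    let ?A1 = "?M (TI p1 1)" and ?A3 = "?M (TI p3 1)"
    \<comment> \<open>The first positions of legs \<open>p1\<close> and \<open>p3\<close> are
      coloured last, as a pair. Keeping \<open>b1\<close> different from \<open>z\<close> and from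
      \<open>b3\<close> makes \<open>diff_lists_distinct\<close> applicable to their lists.\<close>
    obtain z where z: "?A3 \<noteq> ?A1 \<Longrightarrow> z \<in> ?A1 - ?A3"
    proof (cases "?A3 = ?A1")
      case False
      then have "\<not> ?A1 \<subseteq> ?A3" using card_subset_eq[OF fM, of ?A1 eps "TI p3 1"] M(2) by auto
      then show ?thesis using that by blast
    qed (use that in blast)
    \<comment> \<open>Up to that pair, each choice excludes at most four colours from a list of
      five.\<close>
    obtain b1 where b1: "b1 \<in> ?M (TI p1 3)" "b1 \<notin> set [z]" using ex_mem_not_in_list[of "[z]" "?M (TI p1 3)"] M(2) by auto
    obtain w where w: "w \<in> ?M TW" "w \<notin> set [b1]" using ex_mem_not_in_list[of "[b1]" "?M TW"] M(2) by auto
    obtain b2 where b2: "b2 \<in> ?M (TI p2 3)" "b2 \<notin> set [b1, w]" using ex_mem_not_in_list[of "[b1, w]" "?M (TI p2 3)"] M(2) by auto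
    obtain b3 where b3: "b3 \<in> ?M (TI p3 3)" "b3 \<notin> set [b1, w, b2]" using ex_mem_not_in_list[of "[b1, w, b2]" "?M (TI p3 3)"] M(2) by auto
    obtain c2 where c2: "c2 \<in> ?M (TI p2 2)" "c2 \<notin> set [b1, w, b2, b3]"
      using ex_mem_not_in_list[of "[b1, w, b2, b3]" "?M (TI p2 2)"] M(2) by auto
    obtain u where u: "u \<in> ?M TU" "u \<notin> set [w, c2]" using ex_mem_not_in_list[of "[w, c2]" "?M TU"] M(2) by auto
    obtain a2 where a2: "a2 \<in> ?M (TI p2 1)" "a2 \<notin> set [b2, c2, u]"
      using ex_mem_not_in_list[of "[b2, c2, u]" "?M (TI p2 1)"] M(2) by auto
    obtain c1 where c1: "c1 \<in> ?M (TI p1 2)" "c1 \<notin> set [b1, w, u, a2]"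
      using ex_mem_not_in_list[of "[b1, w, u, a2]" "?M (TI p1 2)"] M(2) by auto
    have "\<exists>c d. c \<in> (?A3 - {b3}) - {u, a2, c1} \<and> d \<in> (?A1 - {b1}) - {u, a2, c1} \<and> c \<noteq> d"
    proof (rule distinct_pair[where s = 3])
      show "card {u, a2, c1} \<le> 3" by (simp add: card_insert_if)
      show "3 < card (?A3 - {b3})" "3 < card (?A1 - {b1})"
        using diff_card_le_card_Diff[of "{b3}" ?A3] diff_card_le_card_Diff[of "{b1}" ?A1] M(2)[of eps] by simp_all
      assume eq: "?A3 - {b3} = ?A1 - {b1}"
      show "Suc 3 < card (?A3 - {b3})"
        by (rule diff_lists_distinct[OF _ _ _ _ eq, where z = z]) (use M(2) z b1 b3 in auto)
    qed (use fM in auto)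
    then obtain a1 a3 where a: "a3 \<in> ?A3" "a3 \<notin> {b3, u, a2, c1}" "a1 \<in> ?A1" "a1 \<notin> {b1, u, a2, c1}" "a1 \<noteq> a3" by blast
    note mem = a(1,3) b1(1) w(1) b2(1) b3(1) c2(1) u(1) a2(1) c1(1)
    have inL: "x \<in> L y" "x \<noteq> eps" if "x \<in> ?M y" for x y using that M(1) by blast+
    show ?thesis
      by (rule colourable_by_colours[OF k m n p eps(1) inL(1)[OF u(1)] inL(1)[OF w(1)] inL(1)[OF a(3)]
          inL(1)[OF a2(1)] inL(1)[OF a(1)] inL(1)[OF c1(1)] inL(1)[OF c2(1)] eps(2) inL(1)[OF b1(1)]
          inL(1)[OF b2(1)] inL(1)[OF b3(1)]])
        (use mem[THEN inL(2)] a b1(2) w(2) b2(2) b3(2) c2(2) u(2) a2(2) c1(2) in auto)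
  next
    case False
    have "L (TI 0 1) \<noteq> {}" using c6[of "TI 0 1"] by auto
    then obtain eps where eps: "eps \<in> L (TI 0 1)" by blast
    with False have epsC: "eps \<notin> L (TI 1 2)" "eps \<notin> L (TI 2 2)" "eps \<notin> L (TI 3 2)" by blast+
    let ?M = "M eps"
    let ?A1 = "?M (TI 1 1)" and ?C1 = "L (TI 1 2)"
    \<comment> \<open>Here the middle and the first position of leg 1 come last. Having six colours,
      \<open>?C1\<close> contains a colour \<open>z\<close> missing from the five of
      \<open>?A1\<close>; \<open>w\<close> avoids it.\<close>
    have "\<not> ?C1 \<subseteq> ?A1" using card_mono[OF fM, of ?C1 eps "TI 1 1"] M(2)[of eps "TI 1 1"] c6[of "TI 1 2"] by auto
    then obtain z where z: "z \<in> ?C1" "z \<notin> ?A1" by blast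
    obtain w where w: "w \<in> ?M TW" "w \<notin> set [z]" using ex_mem_not_in_list[of "[z]" "?M TW"] M(2) by auto
    obtain b1 where b1: "b1 \<in> ?M (TI 1 3)" "b1 \<notin> set [w]" using ex_mem_not_in_list[of "[w]" "?M (TI 1 3)"] M(2) by auto
    obtain b2 where b2: "b2 \<in> ?M (TI 2 3)" "b2 \<notin> set [b1, w]" using ex_mem_not_in_list[of "[b1, w]" "?M (TI 2 3)"] M(2) by auto
    obtain b3 where b3: "b3 \<in> ?M (TI 3 3)" "b3 \<notin> set [b1, w, b2]" using ex_mem_not_in_list[of "[b1, w, b2]" "?M (TI 3 3)"] M(2) by auto
    obtain c2 where c2: "c2 \<in> L (TI 2 2)" "c2 \<notin> set [b1, w, b2, b3]"
      using ex_mem_not_in_list[of "[b1, w, b2, b3]" "L (TI 2 2)"] c6 by auto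
    \<comment> \<open>Five colours are excluded, so all six colours of the original list are needed;
      \<open>eps\<close> is not among them.\<close>
    obtain c3 where c3: "c3 \<in> L (TI 3 2)" "c3 \<notin> set [b1, w, b2, b3, c2]"
      using ex_mem_not_in_list[of "[b1, w, b2, b3, c2]" "L (TI 3 2)"] c6 by auto
    obtain u where u: "u \<in> ?M TU" "u \<notin> set [w, c2, c3]" using ex_mem_not_in_list[of "[w, c2, c3]" "?M TU"] M(2) by auto
    obtain a2 where a2: "a2 \<in> ?M (TI 2 1)" "a2 \<notin> set [b2, c2, u]"
      using ex_mem_not_in_list[of "[b2, c2, u]" "?M (TI 2 1)"] M(2) by auto
    obtain a3 where a3: "a3 \<in> ?M (TI 3 1)" "a3 \<notin> set [b3, c3, u, a2]"
      using ex_mem_not_in_list[of "[b3, c3, u, a2]" "?M (TI 3 1)"] M(2) by auto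
    have "\<exists>c d. c \<in> (?C1 - {b1, w}) - {u, a2, a3} \<and> d \<in> (?A1 - {b1}) - {u, a2, a3} \<and> c \<noteq> d"
    proof (rule distinct_pair[where s = 3])
      show "card {u, a2, a3} \<le> 3" by (simp add: card_insert_if)
      have "card {b1, w} \<le> 2" by (rule card_le_2)
      then show "3 < card (?C1 - {b1, w})" "3 < card (?A1 - {b1})"
        using diff_card_le_card_Diff[of "{b1, w}" ?C1] diff_card_le_card_Diff[of "{b1}" ?A1] M(2)[of eps] c6[of "TI 1 2"]
        by simp_all
      assume eq: "?C1 - {b1, w} = ?A1 - {b1}"
      \<comment> \<open>\<open>z\<close> must have been deleted from \<open>?C1\<close>, so it is
        \<open>b1\<close>. Since \<open>z\<close> is not in \<open>?A1\<close>, nothing was deleted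
        there.\<close>
      then have "z = b1" using z w(2) by auto
      then have "?A1 - {b1} = ?A1" using z by blast
      then show "Suc 3 < card (?C1 - {b1, w})" unfolding eq using M(2)[of eps "TI 1 1"] by simp
    qed (use fM finite_L in auto)
    then obtain c1 a1 where a: "c1 \<in> ?C1" "c1 \<notin> {b1, w, u, a2, a3}" "a1 \<in> ?A1" "a1 \<notin> {b1, u, a2, a3}" "c1 \<noteq> a1" by blast
    note mem = a(3) b1(1) w(1) b2(1) b3(1) u(1) a2(1) a3(1)
    have inL: "x \<in> L y" "x \<noteq> eps" if "x \<in> ?M y" for x y using that M(1) by blast+
    have ce: "c1 \<noteq> eps" "c2 \<noteq> eps" "c3 \<noteq> eps" using epsC a(1) c2(1) c3(1) by blast+
    have p: "{1, 2, 3} = {1, 2, 3 :: nat}" "distinct [1, 2, 3 :: nat]" by auto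
    show ?thesis
      by (rule colourable_by_colours[OF k m n p eps inL(1)[OF u(1)] inL(1)[OF w(1)] inL(1)[OF a(3)]
          inL(1)[OF a2(1)] inL(1)[OF a3(1)] a(1) c2(1) c3(1) inL(1)[OF b1(1)]
          inL(1)[OF b2(1)] inL(1)[OF b3(1)]])
        (use mem[THEN inL(2)] ce a b1(2) w(2) b2(2) b3(2) c2(2) c3(2) u(2) a2(2) a3(2) in auto)
  qed
qed

text \<open>Leg \<open>m - 1\<close> is a longest one and plays the part of \<open>M\<close>. Parity
  rules out the lengths 4 and 6 barred in \<open>tight_colourable\<close>, and in the last case it
  leaves \<open>n i = 3\<close> for \<open>0 < i\<close> and \<open>n 0\<close> equal to 1 or
  3.\<close>

lemma all_colourable:
  assumes "0 < m" and odd: "\<And>i. i < m \<Longrightarrow> odd (n i)" and n3: "\<And>i. 0 < i \<Longrightarrow> i < m \<Longrightarrow> 3 \<le> n i"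
    and mono: "\<And>i. i < m \<Longrightarrow> n i \<le> n (m - 1)"
  shows colourable
proof -
  consider "m = 1" | "2 \<le> m" "m + 3 \<le> k" | "2 \<le> m" "k = m + 2" "5 \<le> n (m - 1) \<or> m = 2"
    | "3 \<le> m" "k = m + 2" "n (m - 1) < 5"
    using assms(1) m_k by linarith
  then show ?thesis
  proof cases
    case 1
    then show ?thesis by (rule path_colourable)
  next
    case 2
    show ?thesis by (rule slack_colourable[where M = "m - 1"]) (use 2 n3 in auto)
  next
    case 3
    have "n (m - 1) \<noteq> 6" "n (m - 1) \<noteq> 4" using odd[of "m - 1"] 3 by auto
    then show ?thesis by (intro tight_colourable[where M = "m - 1"]) (use 3 n3 mono in auto)
  next
    case 4
    have le4: "n i \<le> 4" if "i < m" for i using mono[OF that] 4(3) by simp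
    have eq3: "n i = 3" if "0 < i" "i < m" for i
    proof -
      have "n i \<noteq> 4" using odd[OF that(2)] by auto
      then show ?thesis using n3[OF that] le4[OF that(2)] by simp
    qed
    have "n 0 = 1 \<or> n 0 = 3"
    proof -
      have "n 0 \<noteq> 0" "n 0 \<noteq> 2" "n 0 \<noteq> 4" using odd[OF assms(1)] by (metis even_zero even_numeral)+
      then show ?thesis using le4[of 0] assms(1) by linarith
    qed
    then consider "n 0 = 3 \<or> n 0 = 1 \<and> 5 \<le> m" | "n 0 = 1" "m = 3" | "n 0 = 1" "m = 4"
      using 4(1) by linarith
    then show ?thesis
    proof cases
      case 1
      then show ?thesis using three_blocks_colourable 4 eq3 by blast
    next
      case 2
      show ?thesis by (rule five_lists_colourable) (use 2 4 eq3 in auto)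
    next
      case 3
      show ?thesis by (rule six_lists_colourable) (use 3 4 eq3 in auto)
    qed
  qed
qed

end

section \<open>Coordinates on the total graph\<close>

text \<open>Position \<open>2 * h\<close> is the internal vertex \<open>h\<close> and position
  \<open>2 * h + 1\<close> the edge after vertex \<open>h\<close>. A path of length \<open>l\<close>
  thus has the odd number \<open>2 * l - 1\<close> of positions between the branch vertices.\<close>

fun place :: "nat list \<Rightarrow> theta_vertex \<Rightarrow> theta_vertex + theta_vertex set" where
  "place ls TU = Inl TU"
| "place ls TW = Inl TW"
| "place ls (TI i j) = (if even j then Inl (TI i (j div 2))
     else Inr {theta_pv ls i (j div 2), theta_pv ls i (Suc (j div 2))})"

lemma theta_pv_eq:
  assumes "a \<le> ls ! i" "a' \<le> ls ! i'" "1 \<le> ls ! i" "1 \<le> ls ! i'"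
  shows "theta_pv ls i a = theta_pv ls i' a' \<longleftrightarrow>
    a = 0 \<and> a' = 0 \<or> a = ls ! i \<and> a' = ls ! i' \<or> i = i' \<and> a = a'"
  using assms by (auto simp: theta_pv_def)

context
  fixes ls :: "nat list"
  assumes ne: "1 \<le> length ls" and pos: "\<And>i. i < length ls \<Longrightarrow> 1 \<le> ls ! i"
    and simple: "\<And>i. 0 < i \<Longrightarrow> i < length ls \<Longrightarrow> 2 \<le> ls ! i"
begin

abbreviation "len \<equiv> \<lambda>i. 2 * ls ! i - 1"
abbreviation "positions \<equiv> insert TW (spider (length ls) len)"

text \<open>Edges of distinct paths could coincide only if both paths were single edges; this is
  where the graph being simple enters.\<close>

lemma edge_eq:
  assumes "i < length ls" "i' < length ls" "h < ls ! i" "h' < ls ! i'"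
    and "{theta_pv ls i h, theta_pv ls i (Suc h)} = {theta_pv ls i' h', theta_pv ls i' (Suc h')}"
  shows "i = i' \<and> h = h'"
proof -
  note eq = theta_pv_eq[of _ ls i _ i']
  from assms(5) consider "theta_pv ls i h = theta_pv ls i' h'" "theta_pv ls i (Suc h) = theta_pv ls i' (Suc h')"
    | "theta_pv ls i h = theta_pv ls i' (Suc h')" "theta_pv ls i (Suc h) = theta_pv ls i' h'"
    by (auto simp: doubleton_eq_iff)
  then show ?thesis
  proof cases
    case 1
    then show ?thesis using eq[of h h'] eq[of "Suc h" "Suc h'"] assms(1-4) pos[of i] pos[of i'] simple[of i] simple[of i']
      by (cases "i = 0"; cases "i' = 0") auto
  next
    case 2
    then show ?thesis using eq[of h "Suc h'"] eq[of "Suc h" h'] assms(1-4) pos[of i] pos[of i'] by auto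
  qed
qed

lemma inj_on_place: "inj_on (place ls) positions"
proof (rule inj_onI)
  fix x y assume x: "x \<in> positions" and y: "y \<in> positions" and eq: "place ls x = place ls y"
  show "x = y"
  proof (cases x; cases y)
    fix i j i' j' assume xy: "x = TI i j" "y = TI i' j'"
    have ij: "i < length ls" "j < 2 * ls ! i" "i' < length ls" "j' < 2 * ls ! i'" "0 < j" "0 < j'"
      using x y xy by auto
    show "x = y"
    proof (cases "even j")
      case True
      then have "even j'" "i = i'" "j div 2 = j' div 2" using eq xy by (auto split: if_splits)
      then show ?thesis using True xy by (auto elim!: evenE)
    next
      case False
      then have "odd j'" and e: "{theta_pv ls i (j div 2), theta_pv ls i (Suc (j div 2))} =
          {theta_pv ls i' (j' div 2), theta_pv ls i' (Suc (j' div 2))}"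
        using eq xy by (auto split: if_splits)
      have "i = i' \<and> j div 2 = j' div 2"
        by (rule edge_eq[OF _ _ _ _ e]) (use ij in auto)
      then show ?thesis using False \<open>odd j'\<close> xy by (metis odd_two_times_div_two_succ)
    qed
  qed (use x y eq in \<open>auto split: if_splits\<close>)
qed

lemma place_image: "place ls ` positions = total_V (theta_V ls) (theta_E ls)"
proof (rule set_eqI, rule iffI)
  fix z assume "z \<in> place ls ` positions"
  then obtain x where x: "x \<in> positions" "z = place ls x" by blast
  show "z \<in> total_V (theta_V ls) (theta_E ls)"
  proof (cases x)
    case (TI i j)
    then have ij: "i < length ls" "j < 2 * ls ! i" "0 < j" using x(1) by auto
    show ?thesis
    proof (cases "even j")
      case True
      then have "0 < j div 2" "j div 2 < ls ! i" using ij by (auto elim!: evenE)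
      then show ?thesis using x(2) TI True ij by (auto simp: total_V_def theta_V_def)
    next
      case False
      have "j div 2 < ls ! i" using ij by auto
      then show ?thesis using x(2) TI False ij by (auto simp: total_V_def theta_E_def)
    qed
  qed (use x in \<open>auto simp: total_V_def theta_V_def\<close>)
next
  fix z assume "z \<in> total_V (theta_V ls) (theta_E ls)"
  then consider "z = Inl TU" | "z = Inl TW" | i j where "z = Inl (TI i j)" "i < length ls" "0 < j" "j < ls ! i"
    | i j where "z = Inr {theta_pv ls i j, theta_pv ls i (Suc j)}" "i < length ls" "j < ls ! i"
    by (auto simp: total_V_def theta_V_def theta_E_def)
  then show "z \<in> place ls ` positions"
  proof cases
    case 1 then show ?thesis by (intro image_eqI[of _ _ TU]) auto
  next
    case 2 then show ?thesis by (intro image_eqI[of _ _ TW]) auto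
  next
    case (3 i j) then show ?thesis by (intro image_eqI[of _ _ "TI i (2 * j)"]) auto
  next
    case (4 i j) then show ?thesis by (intro image_eqI[of _ _ "TI i (Suc (2 * j))"]) auto
  qed
qed

lemma vertex_cases:
  assumes "x \<in> positions"
  obtains "x = TU" "place ls x = Inl TU" | "x = TW" "place ls x = Inl TW"
  | i h where "x = TI i (2 * h)" "i < length ls" "0 < h" "h < ls ! i" "place ls x = Inl (TI i h)"
  | i h where "x = TI i (Suc (2 * h))" "i < length ls" "h < ls ! i"
    "place ls x = Inr {theta_pv ls i h, theta_pv ls i (Suc h)}"
proof (cases x)
  case (TI i j)
  then have ij: "i < length ls" "j < 2 * ls ! i" "0 < j" using assms by auto
  show ?thesis
  proof (cases "even j")
    case True
    then obtain h where "j = 2 * h" by (auto elim: evenE)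
    then show ?thesis using that(3)[of i h] TI ij by auto
  next
    case False
    then obtain h where "j = Suc (2 * h)" by (auto elim: oddE)
    then show ?thesis using that(4)[of i h] TI ij by auto
  qed
qed (use that assms in auto)

lemma edge_cases:
  assumes "{v, v'} \<in> theta_E ls"
  obtains i j where "i < length ls" "j < ls ! i" "v = theta_pv ls i j" "v' = theta_pv ls i (Suc j)"
  | i j where "i < length ls" "j < ls ! i" "v' = theta_pv ls i j" "v = theta_pv ls i (Suc j)"
  using assms by (auto simp: theta_E_def doubleton_eq_iff)

lemma vertex_edge_adj:
  assumes "i < length ls" "h < ls ! i" "v \<in> {theta_pv ls i h, theta_pv ls i (Suc h)}"
  shows "v = TU \<Longrightarrow> h = 0" "v = TW \<Longrightarrow> Suc h = ls ! i" "v = TI i' h' \<Longrightarrow> i = i' \<and> (h' = h \<or> h' = Suc h)"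
  using assms by (auto simp: theta_pv_def split: if_splits)

text \<open>This direction carries properness back to the total graph. The facts \<open>vv\<close>,
  \<open>ve\<close> and \<open>ee\<close> treat two vertices, a vertex with an edge, and two
  edges.\<close>

lemma place_adj:
  assumes x: "x \<in> positions" and y: "y \<in> positions" and adj: "total_adj (theta_E ls) (place ls x) (place ls y)"
  shows "theta_adj (length ls) len x y"
proof -
  let ?adj = "theta_adj (length ls) len"
  have vv: "?adj x y" if "x \<in> positions" "y \<in> positions" "place ls x = Inl (theta_pv ls i j)"
    "place ls y = Inl (theta_pv ls i (Suc j))" "i < length ls" "j < ls ! i" for x y i j
  proof -
    have x': "x = TU \<and> j = 0 \<or> x = TI i (2 * j) \<and> 0 < j"
      using that by (cases rule: vertex_cases[OF that(1)]) (auto simp: theta_pv_def split: if_splits)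
    have y': "y = TW \<and> Suc j = ls ! i \<or> y = TI i (2 * Suc j) \<and> Suc j < ls ! i"
      using that by (cases rule: vertex_cases[OF that(2)]) (auto simp: theta_pv_def split: if_splits)
    show ?thesis using x' y' that(5) by (auto intro!: exI[of _ i])
  qed
  have ve: "?adj x y" if "x \<in> positions" "place ls x = Inl v" "y = TI i (Suc (2 * h))" "i < length ls" "h < ls ! i"
    "v \<in> {theta_pv ls i h, theta_pv ls i (Suc h)}" for x y v i h
  proof -
    note nbr = vertex_edge_adj[OF that(4-6)]
    show ?thesis
    proof (cases rule: vertex_cases[OF that(1)])
      case 1
      then have "h = 0" using nbr(1) that(2) by simp
      then show ?thesis using 1 that(3) by simp
    next
      case 2
      then have "Suc h = ls ! i" using nbr(2) that(2) by simp
      then show ?thesis using 2 that(3) by simp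
    next
      case (3 i' h')
      then have "i = i' \<and> (h' = h \<or> h' = Suc h)" using nbr(3)[of i' h'] that(2) by simp
      then show ?thesis using 3(1) that(3) by auto
    next
      case (4 i' h')
      then show ?thesis using that(2) by simp
    qed
  qed
  have ee: "?adj x y" if "x = TI i (Suc (2 * h))" "y = TI i' (Suc (2 * h'))" "i < length ls" "h < ls ! i"
    "i' < length ls" "h' < ls ! i'" "i \<noteq> i' \<or> h \<noteq> h'" "theta_pv ls i a = theta_pv ls i' a'"
    "a = h \<or> a = Suc h" "a' = h' \<or> a' = Suc h'" for x y i h i' h' a a'
  proof -
    note pv = that(8)
    have "a \<le> ls ! i" "a' \<le> ls ! i'" using that(4,6,9,10) by auto
    \<comment> \<open>The common endpoint is \<open>TU\<close> or \<open>TW\<close>, or both edges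
      lie on the same path.\<close>
    then consider "a = 0" "a' = 0" | "a = ls ! i" "a' = ls ! i'" | "i = i'" "a = a'"
      using theta_pv_eq[of a ls i a' i'] pos[OF \<open>i < length ls\<close>] pos[OF \<open>i' < length ls\<close>] pv by blast
    then show ?thesis
    proof cases
      case 1
      then have "h = 0" "h' = 0" using that(9,10) by auto
      then show ?thesis using that(1,2,7) by simp
    next
      case 2
      then have "Suc (2 * h) = len i" "Suc (2 * h') = len i'" using that(4,6,9,10) by auto
      moreover have "i \<noteq> i'" using calculation that(7) by auto
      ultimately show ?thesis using that(1,2) by simp
    next
      case 3
      then have "h \<noteq> h'" "h \<le> Suc h'" "h' \<le> Suc h" using that(7,9,10) by auto
      then show ?thesis using that(1,2) 3(1) by simp
    qed
  qed
  show ?thesis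
  proof (cases "place ls x"; cases "place ls y")
    fix v v' assume v: "place ls x = Inl v" "place ls y = Inl v'"
    then have "{v, v'} \<in> theta_E ls" using adj by simp
    then show ?thesis
    proof (cases rule: edge_cases)
      case (1 i j) then show ?thesis using vv[OF x y] v by simp
    next
      case (2 i j) then show ?thesis using vv[OF y x] v theta_adj_sym by simp
    qed
  next
    fix v e assume v: "place ls x = Inl v" "place ls y = Inr e"
    then have "v \<in> e" using adj by simp
    with v show ?thesis using ve[OF x v(1)] by (cases rule: vertex_cases[OF y]) auto
  next
    fix v e assume v: "place ls x = Inr e" "place ls y = Inl v"
    then have "v \<in> e" using adj by simp
    with v have "?adj y x" using ve[OF y v(2)] by (cases rule: vertex_cases[OF x]) auto
    then show ?thesis by (rule theta_adj_sym)
  next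
    fix e e' assume e: "place ls x = Inr e" "place ls y = Inr e'"
    obtain i h where i: "x = TI i (Suc (2 * h))" "i < length ls" "h < ls ! i" "e = {theta_pv ls i h, theta_pv ls i (Suc h)}"
      using e by (cases rule: vertex_cases[OF x]) auto
    obtain i' h' where i': "y = TI i' (Suc (2 * h'))" "i' < length ls" "h' < ls ! i'"
      "e' = {theta_pv ls i' h', theta_pv ls i' (Suc h')}"
      using e by (cases rule: vertex_cases[OF y]) auto
    have "e \<noteq> e'" "e \<inter> e' \<noteq> {}" using adj e by auto
    then have "i \<noteq> i' \<or> h \<noteq> h'" using i i' by auto
    moreover obtain a a' where "theta_pv ls i a = theta_pv ls i' a'" "a = h \<or> a = Suc h" "a' = h' \<or> a' = Suc h'"
      using \<open>e \<inter> e' \<noteq> {}\<close> unfolding i(4) i'(4) by blast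
    ultimately show ?thesis using ee[OF i(1) i'(1) i(2,3) i'(2,3)] by blast
  qed
qed

end

section \<open>Transfer to the original total graph\<close>

text \<open>The number of blocks exceeds \<open>a / k\<close> by less than one, so it is at most the
  ceiling used in the definition of equitability.\<close>

lemma blocks_le_ceiling:
  assumes "0 < k"
  shows "(a + k - 1) div k \<le> nat (ceiling (real a / real k))"
proof -
  let ?q = "(a + k - 1) div k"
  have "?q * k \<le> a + k - 1" by simp
  then have "?q * k < a + k" using assms by linarith
  then have "real ?q * real k < real a + real k" by (metis of_nat_add of_nat_less_iff of_nat_mult)
  then have "real ?q - 1 < real a / real k" using assms by (simp add: field_simps)
  also have "\<dots> \<le> of_int (ceiling (real a / real k))" by (rule le_of_int_ceiling)
  finally show ?thesis by linarith
qed

theorem theorem1p6: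
  fixes ls :: "nat list" and k :: nat
  assumes "length ls \<ge> 1"
    and "\<forall>i < length ls. ls ! i \<ge> 1"
    and "sorted ls"
    and "length ls \<ge> 2 \<longrightarrow> ls ! 1 \<ge> 2"
    and "k \<ge> length ls + 2"
  shows "equitably_choosable (total_V (theta_V ls) (theta_E ls)) (total_adj (theta_E ls)) k"
  unfolding equitably_choosable_def
proof (intro allI impI)
  let ?V = "total_V (theta_V ls) (theta_E ls)"
  let ?m = "length ls" and ?n = "\<lambda>i. 2 * ls ! i - 1"
  fix L assume L: "k_assignment ?V L k"
  have pos: "1 \<le> ls ! i" if "i < ?m" for i using assms(2) that by blast
  have simple: "2 \<le> ls ! i" if "0 < i" "i < ?m" for i
    using assms(4) sorted_nth_mono[OF assms(3), of 1 i] that by simp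
  let ?P = "insert TW (spider ?m ?n)"
  note inj = inj_on_place[OF assms(1) pos simple] and image = place_image[OF assms(1) pos simple]
  \<comment> \<open>Outside the positions any \<open>k\<close> colours serve, since the locale asks
    for lists of size \<open>k\<close> everywhere.\<close>
  define L' where "L' x = (if x \<in> ?P then L (place ls x) else {..<k})" for x
  interpret theta_lists ?m ?n L' k
  proof
    fix x
    show "card (L' x) = k"
      using L image unfolding L'_def k_assignment_def by (auto simp del: insert_iff)
    show "1 \<le> ?n i" if "i < ?m" for i using pos[OF that] by simp
  qed (use assms(5) in simp)
  have colourable
  proof (rule all_colourable)
    show "0 < ?m" using assms(1) by linarith
    show "odd (?n i)" if "i < ?m" for i using pos[OF that] by simp
    show "3 \<le> ?n i" if "0 < i" "i < ?m" for i using simple[OF that] by simp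
    show "?n i \<le> ?n (?m - 1)" if "i < ?m" for i
      using sorted_nth_mono[OF assms(3), of i "?m - 1"] that by (simp add: diff_le_mono)
  qed
  then obtain f where f: "bounded_colouring (theta_adj ?m ?n) L' ((card verts + k - 1) div k) verts f"
    unfolding colourable_def ..
  have VP: "verts = ?P" by (rule verts_def)
  \<comment> \<open>The colouring is carried along the bijection \<open>place ls\<close> from
    positions to vertices and edges.\<close>
  define g where "g = f \<circ> the_inv_into ?P (place ls)"
  have g: "g (place ls x) = f x" if "x \<in> ?P" for x
    using the_inv_into_f_f[OF inj that] by (simp add: g_def)
  have "equitable_L_coloring ?V (total_adj (theta_E ls)) L k g"
    unfolding equitable_L_coloring_def
  proof (intro conjI ballI allI impI)
    fix v assume "v \<in> ?V"
    then obtain x where x: "x \<in> ?P" "v = place ls x" using image by blast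
    then have "f x \<in> L' x" using f VP unfolding bounded_colouring_def by blast
    then show "g v \<in> L v" using x g unfolding L'_def by simp
  next
    fix v v' assume "v \<in> ?V" "v' \<in> ?V" and adj: "total_adj (theta_E ls) v v'"
    then obtain x y where xy: "x \<in> ?P" "v = place ls x" "y \<in> ?P" "v' = place ls y" using image by blast
    then have "theta_adj ?m ?n x y" using place_adj[OF assms(1) pos simple] adj by blast
    then have "f x \<noteq> f y" using f VP xy unfolding bounded_colouring_def by blast
    then show "g v \<noteq> g v'" using xy g by simp
  next
    fix c
    have "{v \<in> ?V. g v = c} = place ls ` {x \<in> ?P. f x = c}"
    proof (intro equalityI subsetI)
      fix v assume "v \<in> {v \<in> ?V. g v = c}"
      then obtain x where x: "x \<in> ?P" "v = place ls x" "g v = c" using image by blast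
      then have "f x = c" using g[OF x(1)] by simp
      with x show "v \<in> place ls ` {x \<in> ?P. f x = c}" by blast
    next
      fix v assume "v \<in> place ls ` {x \<in> ?P. f x = c}"
      then obtain x where x: "x \<in> ?P" "v = place ls x" "f x = c" by blast
      then have "g v = c" using g[OF x(1)] by simp
      with x show "v \<in> {v \<in> ?V. g v = c}" using image by blast
    qed
    also have "card \<dots> = card {x \<in> ?P. f x = c}"
      by (rule card_image) (rule inj_on_subset[OF inj Collect_restrict])
    also have "\<dots> \<le> (card verts + k - 1) div k"
      unfolding VP[symmetric] using f unfolding bounded_colouring_def by blast
    also have "card verts = card ?V" using card_image[OF inj] image VP by simp
    finally show "card {v \<in> ?V. g v = c} \<le> nat (ceiling (real (card ?V) / real k))"
      using blocks_le_ceiling[OF k_pos, of "card ?V"] by linarith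
  qed
  then show "\<exists>f. equitable_L_coloring ?V (total_adj (theta_E ls)) L k f" by blast
qed

end
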